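(* Let $H$ be a path with at least $2$ edges or a cycle and let $W:[0,1]^2\to\mathbb{R}$ be a kernel. For any $\varepsilon\ge 0$, if \[ t_{H}(W) +t_{H}(1-W) \le t_{K_2}(W)^{e(H)} +t_{K_2}(1-W)^{e(H)}+2^{1-e(H)}\varepsilon, \] then, with $U=2W-1$, \[ t_{P_2}(U)\leq t_{K_2}(U)^2 + \frac{\varepsilon}{e(H)-1}. \]
   Context: A kernel is a bounded symmetric measurable function $W:[0,1]^2\to\mathbb{R}$. For a graph $F$, $t_F(W):=\int_{[0,1]^{V(F)}}\prod_{ij\in E(F)}W(x_i,x_j)\prod_{i\in V(F)}dx_i$. $e(H)$ is the number of edges of $H$; $K_2$ is a single edge; $P_2$ is the path with $2$ edges; $1-W$ and $2W-1$ denote the kernels $(x,y)\mapsto 1-W(x,y)$ and $(x,y)\mapsto 2W(x,y)-1$. *)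

theory Defs
  imports "HOL-Analysis.Analysis"
begin

text \<open>A graph is a pair of a vertex set and a set of unordered edges.\<close>

type_synonym 'v graph = "'v set \<times> 'v set set"

abbreviation verts :: "'v graph \<Rightarrow> 'v set" where
  "verts \<equiv> fst"

abbreviation edges :: "'v graph \<Rightarrow> 'v set set" where
  "edges \<equiv> snd"

definition simple_graph :: "'v graph \<Rightarrow> bool" where
  "simple_graph F \<longleftrightarrow> finite (verts F) \<and> (\<forall>e\<in>edges F. e \<subseteq> verts F \<and> card e = 2)"

definition num_edges :: "'v graph \<Rightarrow> nat" where
  "num_edges F = card (edges F)"

definition graph_iso :: "'v graph \<Rightarrow> 'w graph \<Rightarrow> bool" where
  "graph_iso F G \<longleftrightarrow> (\<exists>f. bij_betw f (verts F) (verts G) \<and>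
     (\<forall>i\<in>verts F. \<forall>j\<in>verts F. {i, j} \<in> edges F \<longleftrightarrow> {f i, f j} \<in> edges G))"

definition complete_graph :: "nat \<Rightarrow> nat graph" where
  "complete_graph n = ({..<n}, {{i, j} | i j. i < n \<and> j < n \<and> i \<noteq> j})"

text \<open>The index of a path is its number of edges, not of vertices.\<close>

definition path_graph :: "nat \<Rightarrow> nat graph" where
  "path_graph k = ({..k}, {{i, Suc i} | i. i < k})"

definition cycle_graph :: "nat \<Rightarrow> nat graph" where
  "cycle_graph k = ({..<k}, {{i, Suc i mod k} | i. i < k})"

definition is_path :: "'v graph \<Rightarrow> bool" where
  "is_path F \<longleftrightarrow> simple_graph F \<and> (\<exists>k. graph_iso F (path_graph k))"

definition is_cycle :: "'v graph \<Rightarrow> bool" where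
  "is_cycle F \<longleftrightarrow> simple_graph F \<and> (\<exists>k\<ge>3. graph_iso F (cycle_graph k))"

text \<open>A kernel is given by a total function of which only the values on the unit
  square matter. Measurability is in the sense of Lebesgue.\<close>

definition is_kernel :: "(real \<Rightarrow> real \<Rightarrow> real) \<Rightarrow> bool" where
  "is_kernel W \<longleftrightarrow>
     bounded ((\<lambda>(x, y). W x y) ` ({0..1} \<times> {0..1})) \<and>
     (\<forall>x\<in>{0..1}. \<forall>y\<in>{0..1}. W x y = W y x) \<and>
     (\<lambda>(x, y). W x y) \<in> borel_measurable (lebesgue_on ({0..1} \<times> {0..1}))"

text \<open>The factor of an unordered edge; unambiguous because kernels are symmetric
  (see \<open>edge_weight_doubleton\<close>).\<close>

definition edge_weight :: "(real \<Rightarrow> real \<Rightarrow> real) \<Rightarrow> ('v \<Rightarrow> real) \<Rightarrow> 'v set \<Rightarrow> real" where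
  "edge_weight W x e = (THE r. \<exists>i j. e = {i, j} \<and> r = W (x i) (x j))"

lemma edge_weight_doubleton:
  assumes "is_kernel W" "x i \<in> {0..1}" "x j \<in> {0..1}"
  shows "edge_weight W x {i, j} = W (x i) (x j)"
  unfolding edge_weight_def
proof (rule the_equality)
  show "\<exists>i' j'. {i, j} = {i', j'} \<and> W (x i) (x j) = W (x i') (x j')"
    by blast
next
  fix r assume "\<exists>i' j'. {i, j} = {i', j'} \<and> r = W (x i') (x j')"
  then obtain i' j' where "{i, j} = {i', j'}" and r: "r = W (x i') (x j')"
    by blast
  then have "(i' = i \<and> j' = j) \<or> (i' = j \<and> j' = i)"
    by (auto simp: doubleton_eq_iff)
  then show "r = W (x i) (x j)"
    using assms r unfolding is_kernel_def by metis
qed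

text \<open>The completed finite product is Lebesgue measure on the cube indexed by the
  vertices. Completion is needed because the integrand is only Lebesgue measurable.\<close>

definition hom_density :: "'v graph \<Rightarrow> (real \<Rightarrow> real \<Rightarrow> real) \<Rightarrow> real" where
  "hom_density F W =
     (\<integral>x. (\<Prod>e\<in>edges F. edge_weight W x e)
        \<partial>completion (Pi\<^sub>M (verts F) (\<lambda>_. restrict_space lborel {0..1})))"

end

theory Submission
  imports "HOL-Probability.Probability" Defs
begin

text \<open>Put \<open>W = (1 + U) / 2\<close> and \<open>1 - W = (1 - U) / 2\<close>. In \<open>t\<^sub>H(1 + U) + t\<^sub>H(1 - U)\<close> only the
  even degrees in \<open>U\<close> survive, and the claim is that each even degree \<open>k\<close> contributes at least
  its share \<open>(e(H) choose k) p\<^sup>k\<close>, where \<open>p = t\<^bsub>K\<^sub>2\<^esub>(U)\<close>; the hypothesis then bounds the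
  excess in degree \<open>2\<close>, which is \<open>e(H) - 1\<close> or \<open>e(H)\<close> times \<open>t\<^bsub>P\<^sub>2\<^esub>(U) - p\<^sup>2\<close>.

  Let \<open>m\<^sub>i\<close> be the density of the path with \<open>i\<close> edges, that is, the \<open>i\<close>-th moment of the
  spectral measure of \<open>U\<close> at the constant function \<open>1\<close>, and let \<open>h\<close> be the power series with
  coefficients \<open>m\<^sub>i\<close>. For a path the degree \<open>k\<close> part is the coefficient of \<open>y\<^sup>k\<close> in
  \<open>h(y)\<^sup>n\<close> with \<open>n = e(H) - k + 1\<close>; for a cycle it is \<open>e(H) / n\<close> times that coefficient with
  \<open>n = e(H) - k\<close>, except for \<open>k = e(H)\<close>, where the trace of \<open>U\<^sup>k\<close> is at least \<open>m\<^sub>k\<close>. This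
  coefficient is the expectation of the complete homogeneous symmetric polynomial of degree
  \<open>k\<close> in \<open>n\<close> independent variables with mean \<open>p\<close>. For even \<open>k\<close> the polynomial is convex, so
  by Jensen it is at least \<open>((n + k - 1) choose k) p\<^sup>k\<close>. The spectral measure itself is
  avoided: positive semidefiniteness of the Hankel forms of the moment sequences suffices.\<close>

section \<open>Positive semidefinite Hankel forms\<close>

text \<open>When \<open>m\<close> lists the moments of a measure on the line, the form is the
  integral of the square of the polynomial with coefficients \<open>c\<close>. This consequence is
  all that is kept of a representing measure.\<close>

definition hankel_psd :: "(nat \<Rightarrow> real) \<Rightarrow> bool" where
  "hankel_psd m \<longleftrightarrow> (\<forall>l c. 0 \<le> (\<Sum>i\<le>l. \<Sum>j\<le>l. c i * c j * m (i + j)))"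

lemma hankel_psdD: "hankel_psd m \<Longrightarrow> 0 \<le> (\<Sum>i\<le>l. \<Sum>j\<le>l. c i * c j * m (i + j))"
  by (simp add: hankel_psd_def)

text \<open>Corresponds to scaling the variable by \<open>r\<close>: the factor r^(i + j) splits and
  is absorbed into the coefficients.\<close>

lemma hankel_psd_geometric:
  assumes "hankel_psd m"
  shows "hankel_psd (\<lambda>i. r ^ i * m i)"
  unfolding hankel_psd_def
proof (intro allI)
  fix l :: nat and c :: "nat \<Rightarrow> real"
  have "0 \<le> (\<Sum>i\<le>l. \<Sum>j\<le>l. (c i * r ^ i) * (c j * r ^ j) * m (i + j))"
    by (rule hankel_psdD[OF assms, where c = "\<lambda>i. c i * r ^ i"])
  also have "\<dots> = (\<Sum>i\<le>l. \<Sum>j\<le>l. c i * c j * (r ^ (i + j) * m (i + j)))"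
    by (simp only: power_add mult_ac)
  finally show "0 \<le> (\<Sum>i\<le>l. \<Sum>j\<le>l. c i * c j * (r ^ (i + j) * m (i + j)))" .
qed

lemma hankel_psd_quadratic:
  assumes "hankel_psd m"
  shows "0 \<le> x\<^sup>2 * m (2 * a) + 2 * x * y * m (a + b) + y\<^sup>2 * m (2 * b)"
proof -
  \<comment> \<open>Adding two indicators, instead of nesting the cases, also covers
    \<open>a = b\<close>.\<close>
  define c where "c i = (if i = a then x else 0) + (if i = b then y else 0)" for i
  have inner: "(\<Sum>j\<le>max a b. c j * g j) = x * g a + y * g b" for g
  proof -
    have "(\<Sum>j\<le>max a b. c j * g j) =
        (\<Sum>j\<le>max a b. (if j = a then x * g j else 0) + (if j = b then y * g j else 0))"
      by (intro sum.cong) (auto simp: c_def distrib_right)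
    also have "\<dots> = x * g a + y * g b"
      by (simp only: sum.distrib sum.delta finite_atMost atMost_iff max.cobounded1 max.cobounded2 if_True)
    finally show ?thesis .
  qed
  have "0 \<le> (\<Sum>i\<le>max a b. \<Sum>j\<le>max a b. c i * c j * m (i + j))"
    by (rule hankel_psdD[OF assms])
  also have "\<dots> = (\<Sum>i\<le>max a b. c i * (\<Sum>j\<le>max a b. c j * m (i + j)))"
    by (simp only: sum_distrib_left mult.assoc)
  also have "\<dots> = x * (x * m (a + a) + y * m (a + b)) + y * (x * m (b + a) + y * m (b + b))"
    unfolding inner ..
  also have "\<dots> = x\<^sup>2 * m (2 * a) + 2 * x * y * m (a + b) + y\<^sup>2 * m (2 * b)"
    unfolding power2_eq_square mult_2 add.commute[of b a] by algebra
  finally show ?thesis .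
qed

lemma hankel_psd_even_nonneg: "hankel_psd m \<Longrightarrow> 0 \<le> m (2 * a)"
  using hankel_psd_quadratic[of m 1 a 0 a] by simp

lemma hankel_psd_cauchy_schwarz:
  assumes "hankel_psd m"
  shows "(m (a + b))\<^sup>2 \<le> m (2 * a) * m (2 * b)"
proof (cases "m (2 * b) = 0")
  case True
  have "m (a + b) = 0"
  proof (rule ccontr)
    assume "m (a + b) \<noteq> 0"
    \<comment> \<open>With \<open>m (2 * b) = 0\<close> the form is affine in the second
      coefficient, and this choice gives it the value -1.\<close>
    then show False
      using hankel_psd_quadratic[OF assms, of 1 a "- (m (2 * a) + 1) / (2 * m (a + b))" b] True
      by (simp add: field_simps)
  qed
  then show ?thesis by (simp add: True)
next
  case False
  then have pos: "0 < m (2 * b)"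
    using hankel_psd_even_nonneg[OF assms, of b] by simp
  \<comment> \<open>The inserted coefficients are, up to scaling, the minimiser of the form.\<close>
  have "0 \<le> m (2 * b) * (m (2 * a) * m (2 * b) - (m (a + b))\<^sup>2)"
    using hankel_psd_quadratic[OF assms, of "m (2 * b)" a "- m (a + b)" b]
    by (simp add: power2_eq_square algebra_simps)
  then show ?thesis
    using pos by (simp add: zero_le_mult_iff)
qed

text \<open>Jensen's inequality for even powers, from log-convexity: by Cauchy-Schwarz the ratios of
  consecutive even moments do not decrease, and the first ratio is at least (m 1)^2. The case
  \<open>m 1 = 0\<close> is separate because the ratios require positive even moments.\<close>

lemma hankel_psd_even_ge_power:
  assumes "hankel_psd m" and "m 0 = 1"
  shows "m 1 ^ (2 * l) \<le> m (2 * l)"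
proof (cases "m 1 = 0")
  case True
  then show ?thesis
    using hankel_psd_even_nonneg[OF assms(1), of l] assms(2) by (cases l) auto
next
  case False
  have "0 < m (2 * l) \<and> (m 1)\<^sup>2 * m (2 * l) \<le> m (2 * Suc l)" for l
  proof (induction l)
    case 0
    show ?case
      using hankel_psd_cauchy_schwarz[OF assms(1), of 0 1] assms(2) by simp
  next
    case (Suc l)
    have pos: "0 < m (2 * Suc l)"
      using Suc False by (meson less_le_trans mult_pos_pos zero_less_power2)
    have "m (2 * l) * ((m 1)\<^sup>2 * m (2 * Suc l)) \<le> (m (2 * Suc l))\<^sup>2"
      using mult_right_mono[of "(m 1)\<^sup>2 * m (2 * l)" "m (2 * Suc l)" "m (2 * Suc l)"] Suc pos
      by (simp add: power2_eq_square algebra_simps)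
    also have "\<dots> \<le> m (2 * l) * m (2 * Suc (Suc l))"
      using hankel_psd_cauchy_schwarz[OF assms(1), of l "Suc (Suc l)"] by (simp add: mult_2)
    finally show ?case
      using Suc pos by simp
  qed
  note step = this
  show ?thesis
  proof (induction l)
    case 0
    show ?case using assms(2) by simp
  next
    case (Suc l)
    have "m 1 ^ (2 * Suc l) = (m 1)\<^sup>2 * m 1 ^ (2 * l)"
      by (simp add: power2_eq_square)
    also have "\<dots> \<le> (m 1)\<^sup>2 * m (2 * l)"
      using Suc by (intro mult_left_mono) auto
    finally show ?case
      using step[of l] by linarith
  qed
qed

section \<open>Binomial convolutions and sums of independent variables\<close>

definition binomial_convolution :: "nat \<Rightarrow> (nat \<Rightarrow> nat \<Rightarrow> real) \<Rightarrow> real" where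
  "binomial_convolution n X = (\<Sum>i\<le>n. real (n choose i) * X i (n - i))"

text \<open>Umbrally, the convolution is (x + y)^n with x^a y^b replaced by \<open>X a b\<close>;
  here one factor x + y is split off by Pascal's rule. A general array, rather than a product of two
  sequences, keeps both shifts within this form.\<close>

lemma binomial_convolution_Suc:
  "binomial_convolution (Suc n) X = binomial_convolution n (\<lambda>a b. X (Suc a) b + X a (Suc b))"
proof -
  have *: "(\<Sum>i\<le>n. real (n choose Suc i) * X (Suc i) (n - i)) + X 0 (Suc n) =
      (\<Sum>i\<le>n. real (n choose i) * X i (Suc n - i))"
    using sum.atMost_Suc_shift[of "\<lambda>i. real (n choose i) * X i (Suc n - i)" n]
    by (simp add: binomial_eq_0[of n "Suc n"] add.commute)
  have "binomial_convolution (Suc n) X =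
      X 0 (Suc n) + (\<Sum>i\<le>n. real ((n choose i) + (n choose Suc i)) * X (Suc i) (n - i))"
    unfolding binomial_convolution_def by (subst sum.atMost_Suc_shift) simp
  also have "\<dots> = (\<Sum>i\<le>n. real (n choose i) * X (Suc i) (n - i)) +
      (\<Sum>i\<le>n. real (n choose i) * X i (Suc n - i))"
    using * by (simp add: sum.distrib distrib_right)
  also have "\<dots> = binomial_convolution n (\<lambda>a b. X (Suc a) b + X a (Suc b))"
    unfolding binomial_convolution_def sum.distrib[symmetric] distrib_left
    by (intro sum.cong) (auto simp: Suc_diff_le)
  finally show ?thesis .
qed

lemma binomial_convolution_sum:
  "binomial_convolution n (\<lambda>a b. X a b + Y a b) =
    binomial_convolution n X + binomial_convolution n Y"
  by (simp add: binomial_convolution_def sum.distrib distrib_left)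

text \<open>Umbrally (x + y)^(n + k) = (x + y)^n (x + y)^k. It separates the two indices of a Hankel
  entry.\<close>

lemma binomial_convolution_add:
  "binomial_convolution (n + k) X =
    binomial_convolution n (\<lambda>a b. binomial_convolution k (\<lambda>a' b'. X (a + a') (b + b')))"
proof (induction n arbitrary: X)
  case 0
  show ?case by (simp add: binomial_convolution_def)
next
  case (Suc n)
  show ?case
    by (simp add: binomial_convolution_Suc Suc binomial_convolution_sum)
qed

lemma binomial_convolution_extend:
  assumes "n \<le> l"
  shows "binomial_convolution n X = (\<Sum>i\<le>l. real (n choose i) * X i (n - i))"
  unfolding binomial_convolution_def
  using assms by (intro sum.mono_neutral_left) auto

text \<open>If \<open>N\<close> and \<open>m\<close> are the moments of independent random variables, then the
  binomial convolution gives the moments of their sum.\<close>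

lemma hankel_psd_binomial_convolution:
  fixes v :: "nat \<Rightarrow> 'a \<Rightarrow> real"
  assumes N: "hankel_psd N"
    and int: "\<And>i j. integrable M (\<lambda>x. v i x * v j x)"
    and m: "\<And>i j. m (i + j) = (\<integral>x. v i x * v j x \<partial>M)"
  shows "hankel_psd (\<lambda>n. binomial_convolution n (\<lambda>i j. N i * m j))"
  unfolding hankel_psd_def
proof (intro allI)
  fix l :: nat and c :: "nat \<Rightarrow> real"
  \<comment> \<open>For the polynomial P with coefficients \<open>c\<close>, this is the coefficient
    of s^a in P(s + y), with y^i replaced by \<open>v i x\<close>. For each x the integrand thus
    becomes the Hankel form of \<open>N\<close> at the coefficients \<open>e a x\<close>. Where
    \<open>j < a\<close> the binomial coefficient vanishes, so truncated subtraction does no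
    harm.\<close>
  define e where "e a x = (\<Sum>j\<le>l. c j * real (j choose a) * v (j - a) x)" for a x
  have "(\<Sum>i\<le>l. \<Sum>j\<le>l. c i * c j * binomial_convolution (i + j) (\<lambda>i j. N i * m j)) =
    (\<Sum>i\<le>l. \<Sum>j\<le>l. \<Sum>a\<le>l. \<Sum>b\<le>l. c i * c j * real (i choose a) * real (j choose b) * N (a + b)
      * (\<integral>x. v (i - a) x * v (j - b) x \<partial>M))"
  proof (intro sum.cong refl)
    fix i j assume "i \<in> {..l}" "j \<in> {..l}"
    then show "c i * c j * binomial_convolution (i + j) (\<lambda>i j. N i * m j) = (\<Sum>a\<le>l. \<Sum>b\<le>l.
        c i * c j * real (i choose a) * real (j choose b) * N (a + b) * (\<integral>x. v (i - a) x * v (j - b) x \<partial>M))"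
      unfolding binomial_convolution_add m[symmetric]
      by (simp add: binomial_convolution_extend[of _ l] sum_distrib_left mult.assoc)
  qed
  also have "\<dots> = (\<integral>x. (\<Sum>i\<le>l. \<Sum>j\<le>l. \<Sum>a\<le>l. \<Sum>b\<le>l.
      c i * c j * real (i choose a) * real (j choose b) * N (a + b) * (v (i - a) x * v (j - b) x)) \<partial>M)"
    using int by (simp add: Bochner_Integration.integral_sum)
  also have "\<dots> = (\<integral>x. (\<Sum>a\<le>l. \<Sum>b\<le>l. e a x * e b x * N (a + b)) \<partial>M)"
  proof (intro Bochner_Integration.integral_cong refl)
    fix x
    have "(\<Sum>a\<le>l. \<Sum>b\<le>l. e a x * e b x * N (a + b)) =
      (\<Sum>a\<le>l. \<Sum>b\<le>l. \<Sum>i\<le>l. \<Sum>j\<le>l.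
        c i * c j * real (i choose a) * real (j choose b) * N (a + b) * (v (i - a) x * v (j - b) x))"
      unfolding e_def sum_product unfolding sum_distrib_right by (simp only: mult_ac)
    also have "\<dots> = (\<Sum>a\<le>l. \<Sum>i\<le>l. \<Sum>b\<le>l. \<Sum>j\<le>l.
        c i * c j * real (i choose a) * real (j choose b) * N (a + b) * (v (i - a) x * v (j - b) x))"
      by (intro sum.cong refl sum.swap)
    also have "\<dots> = (\<Sum>a\<le>l. \<Sum>i\<le>l. \<Sum>j\<le>l. \<Sum>b\<le>l.
        c i * c j * real (i choose a) * real (j choose b) * N (a + b) * (v (i - a) x * v (j - b) x))"
      by (intro sum.cong refl sum.swap)
    also have "\<dots> = (\<Sum>i\<le>l. \<Sum>a\<le>l. \<Sum>j\<le>l. \<Sum>b\<le>l.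
        c i * c j * real (i choose a) * real (j choose b) * N (a + b) * (v (i - a) x * v (j - b) x))"
      by (rule sum.swap)
    also have "\<dots> = (\<Sum>i\<le>l. \<Sum>j\<le>l. \<Sum>a\<le>l. \<Sum>b\<le>l.
        c i * c j * real (i choose a) * real (j choose b) * N (a + b) * (v (i - a) x * v (j - b) x))"
      by (intro sum.cong refl sum.swap)
    finally show "(\<Sum>i\<le>l. \<Sum>j\<le>l. \<Sum>a\<le>l. \<Sum>b\<le>l.
        c i * c j * real (i choose a) * real (j choose b) * N (a + b) * (v (i - a) x * v (j - b) x)) =
      (\<Sum>a\<le>l. \<Sum>b\<le>l. e a x * e b x * N (a + b))" ..
  qed
  also have "\<dots> \<ge> 0"
    by (intro integral_nonneg_AE always_eventually allI hankel_psdD[OF N])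
  finally show "0 \<le> (\<Sum>i\<le>l. \<Sum>j\<le>l. c i * c j *
      binomial_convolution (i + j) (\<lambda>i j. N i * m j))" .
qed

section \<open>Moments of random convex combinations\<close>

lemma has_integral_Beta_fact:
  "((\<lambda>t::real. t ^ a * (1 - t) ^ b) has_integral (fact a * fact b / fact (a + b + 1))) {0..1}"
proof -
  have "((\<lambda>t. t powr (real (Suc a) - 1) * (1 - t) powr (real (Suc b) - 1)) has_integral
      Beta (real (Suc a)) (real (Suc b))) {0..1}"
    by (intro has_integral_Beta_real) auto
  moreover have "Beta (real (Suc a)) (real (Suc b)) = fact a * fact b / fact (a + b + 1)"
    unfolding Beta_def using Gamma_fact[of a, where 'a=real] Gamma_fact[of b, where 'a=real]
      Gamma_fact[of "a + b + 1", where 'a=real] by (simp add: ac_simps)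
  ultimately have *: "((\<lambda>t. t powr real a * (1 - t) powr real b) has_integral
      fact a * fact b / fact (a + b + 1)) {0..1}" by simp
  \<comment> \<open>At the endpoints \<open>0 powr 0 = 0\<close> but \<open>0 ^ 0 = 1\<close>, so
    the two integrands are compared off a null set.\<close>
  have "((\<lambda>t::real. t powr real a * (1 - t) powr real b) has_integral
      fact a * fact b / fact (a + b + 1)) {0..1} \<longleftrightarrow>
    ((\<lambda>t::real. t ^ a * (1 - t) ^ b) has_integral fact a * fact b / fact (a + b + 1)) {0..1}"
    by (rule has_integral_spike_eq[of "{0, 1}"]) (auto simp: powr_realpow)
  with * show ?thesis by simp
qed

text \<open>With \<open>m\<close> the moments of a random variable \<open>\<lambda>\<close>, the \<open>k\<close>-th coefficient of the
  \<open>n\<close>-th power is the expectation of the complete homogeneous symmetric polynomial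
  \<open>h\<^sub>k\<close> of \<open>n\<close> independent copies of \<open>\<lambda>\<close>; divided by \<open>h\<^sub>k(1,\<dots>,1)\<close> it is the \<open>k\<close>-th moment
  of a random convex combination of these copies, with weights uniform on the simplex.\<close>

definition simplex_moment :: "(nat \<Rightarrow> real) \<Rightarrow> nat \<Rightarrow> nat \<Rightarrow> real" where
  "simplex_moment m n k = fps_nth (Abs_fps m ^ n) k / real ((n + k - 1) choose k)"

text \<open>Splitting off one copy: its weight has the density \<open>n (1 - t)\<^sup>n\<^sup>-\<^sup>1\<close>.\<close>

lemma has_integral_simplex_moment_Suc:
  assumes "0 < n"
  shows "((\<lambda>t. real n * (1 - t) ^ (n - 1) * binomial_convolution k
      (\<lambda>i j. ((1 - t) ^ i * simplex_moment m n i) * (t ^ j * m j)))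
    has_integral simplex_moment m (Suc n) k) {0..1}"
proof -
  have "((\<lambda>t. \<Sum>i\<le>k. (real n * real (k choose i) * simplex_moment m n i * m (k - i)) *
      (t ^ (k - i) * (1 - t) ^ (n - 1 + i))) has_integral
    (\<Sum>i\<le>k. (real n * real (k choose i) * simplex_moment m n i * m (k - i)) *
      (fact (k - i) * fact (n - 1 + i) / fact (k - i + (n - 1 + i) + 1)))) {0..1}"
    by (intro has_integral_sum finite_atMost has_integral_mult_right has_integral_Beta_fact)
  moreover have "(\<Sum>i\<le>k. (real n * real (k choose i) * simplex_moment m n i * m (k - i)) *
      (fact (k - i) * fact (n - 1 + i) / fact (k - i + (n - 1 + i) + 1))) = simplex_moment m (Suc n) k"
  proof -
    \<comment> \<open>The Beta integral trades the normalisation for degree i in n variables for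
      that of degree k in n + 1 variables; what remains is the Cauchy product defining the next
      power.\<close>
    have "(real n * real (k choose i) * simplex_moment m n i * m (k - i)) *
        (fact (k - i) * fact (n - 1 + i) / fact (k - i + (n - 1 + i) + 1)) =
      fps_nth (Abs_fps m ^ n) i * m (k - i) / real (n + k choose k)" if "i \<le> k" for i
    proof -
      obtain n' where n': "n = Suc n'" using assms by (cases n) auto
      obtain j where k: "k = i + j" using \<open>i \<le> k\<close> le_Suc_ex by blast
      have c1: "real (k choose i) = fact (i + j) / (fact i * fact j)"
        by (simp add: k binomial_fact)
      have c2: "real ((n + i - 1) choose i) = fact (n' + i) / (fact i * fact n')"
        by (simp add: n' binomial_fact)
      have c3: "real ((n + k) choose k) = fact (n' + i + j + 1) / (fact (i + j) * fact (Suc n'))"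
        by (simp add: n' k binomial_fact ac_simps del: fact_Suc)
      have f: "fact (Suc n') = real n * fact n'" by (simp add: n')
      have "k - i = j" "n - 1 = n'" by (simp_all add: k n')
      moreover have "n' + i + j + 1 = j + (n' + i) + 1" by simp
      ultimately show ?thesis
        unfolding simplex_moment_def c1 c2 c3 f
        by (simp only:) (simp add: n' divide_simps del: fact_Suc)
    qed
    then show ?thesis
      unfolding simplex_moment_def[of m "Suc n"] power_Suc2 fps_mult_nth
      by (simp add: sum_divide_distrib atMost_atLeast0)
  qed
  ultimately show ?thesis
    by (simp add: binomial_convolution_def sum_distrib_left power_add mult_ac)
qed

text \<open>Given the weight t of the last copy, the convex combination is the sum of (1 - t) times
  the previous combination and t times an independent copy. Scaling, binomial convolution and
  integration against a nonnegative density all preserve positivity. The functions \<open>v\<close>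
  give the Gram representation of \<open>m\<close> that the convolution step asks of its second
  factor.\<close>

lemma hankel_psd_simplex_moment:
  fixes v :: "nat \<Rightarrow> 'a \<Rightarrow> real"
  assumes int: "\<And>i j. integrable M (\<lambda>x. v i x * v j x)"
    and m: "\<And>i j. m (i + j) = (\<integral>x. v i x * v j x \<partial>M)"
    and "0 < n"
  shows "hankel_psd (simplex_moment m n)"
  using \<open>0 < n\<close>
proof (induction n rule: nat_induct_non_zero)
  case 1
  \<comment> \<open>The moments of the constant 0; convolving with them gives back \<open>m\<close>,
    so the base case is also an instance of the convolution lemma.\<close>
  have delta: "hankel_psd (\<lambda>i. if i = 0 then 1 else 0)"
    unfolding hankel_psd_def
  proof (intro allI)
    fix l :: nat and c :: "nat \<Rightarrow> real"
    have "(\<Sum>i\<le>l. \<Sum>j\<le>l. c i * c j * (if i + j = 0 then 1 else 0)) =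
      (\<Sum>i\<le>l. \<Sum>j\<le>l. if j = 0 then (if i = 0 then c 0 * c 0 else 0) else 0)"
      by (intro sum.cong refl) auto
    then show "0 \<le> (\<Sum>i\<le>l. \<Sum>j\<le>l. c i * c j * (if i + j = 0 then 1 else 0))"
      by simp
  qed
  have "simplex_moment m 1 = (\<lambda>k. binomial_convolution k (\<lambda>i j. (if i = 0 then 1 else 0) * m j))"
    by (intro ext) (simp add: simplex_moment_def binomial_convolution_def
        if_distrib[of "\<lambda>t. t * _"] if_distrib[of "\<lambda>t. _ * t"] cong: if_cong)
  then show ?case
    using hankel_psd_binomial_convolution[OF delta, where M = M and v = v and m = m] int m by simp
next
  case (Suc n)
  show ?case
    unfolding hankel_psd_def
  proof (intro allI)
    fix l :: nat and c :: "nat \<Rightarrow> real"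
    let ?b = "\<lambda>t k. binomial_convolution k
      (\<lambda>i j. ((1 - t) ^ i * simplex_moment m n i) * (t ^ j * m j))"
    have "((\<lambda>t. \<Sum>i\<le>l. \<Sum>j\<le>l. c i * c j * (real n * (1 - t) ^ (n - 1) * ?b t (i + j)))
      has_integral (\<Sum>i\<le>l. \<Sum>j\<le>l. c i * c j * simplex_moment m (Suc n) (i + j))) {0..1}"
      using Suc.hyps by (intro has_integral_sum finite_atMost has_integral_mult_right
          has_integral_simplex_moment_Suc)
    moreover have "0 \<le> (\<Sum>i\<le>l. \<Sum>j\<le>l. c i * c j * (real n * (1 - t) ^ (n - 1) * ?b t (i + j)))"
      if "t \<in> {0..1}" for t
    proof -
      have "hankel_psd (?b t)"
      proof (rule hankel_psd_binomial_convolution)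
        show "integrable M (\<lambda>x. (t ^ i * v i x) * (t ^ j * v j x))" for i j
          using integrable_mult_right[OF int[of i j], of "t ^ i * t ^ j"] by (simp add: ac_simps)
        show "t ^ (i + j) * m (i + j) = (\<integral>x. (t ^ i * v i x) * (t ^ j * v j x) \<partial>M)" for i j
          using Bochner_Integration.integral_mult_right_zero[of M "t ^ (i + j)" "\<lambda>x. v i x * v j x"]
          by (simp add: m power_add ac_simps)
      qed (intro hankel_psd_geometric Suc.IH)
      then have "0 \<le> real n * (1 - t) ^ (n - 1) * (\<Sum>i\<le>l. \<Sum>j\<le>l. c i * c j * ?b t (i + j))"
        using that by (intro mult_nonneg_nonneg hankel_psdD) auto
      then show ?thesis
        by (simp add: sum_distrib_left ac_simps)
    qed
    ultimately show "0 \<le> (\<Sum>i\<le>l. \<Sum>j\<le>l. c i * c j * simplex_moment m (Suc n) (i + j))"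
      by (rule has_integral_nonneg)
  qed
qed

section \<open>The lower bound for even coefficients\<close>

lemma fps_power_nth_1:
  fixes f :: "'a::comm_ring_1 fps"
  assumes "fps_nth f 0 = 1"
  shows "fps_nth (f ^ n) 0 = 1" and "fps_nth (f ^ n) 1 = of_nat n * fps_nth f 1"
proof -
  show *: "fps_nth (f ^ n) 0 = 1" for n
    by (induction n) (simp_all add: assms)
  show "fps_nth (f ^ n) 1 = of_nat n * fps_nth f 1"
    by (induction n) (simp_all add: assms fps_mult_nth * algebra_simps)
qed

text \<open>Jensen for the random convex combination, whose mean is \<open>m 1\<close>. The binomial
  coefficient counts the monomials of degree k in n variables and undoes the normalisation of
  \<open>simplex_moment\<close>.\<close>

lemma even_nth_fps_power_ge:
  fixes v :: "nat \<Rightarrow> 'a \<Rightarrow> real"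
  assumes int: "\<And>i j. integrable M (\<lambda>x. v i x * v j x)"
    and m: "\<And>i j. m (i + j) = (\<integral>x. v i x * v j x \<partial>M)"
    and "m 0 = 1" "0 < n" "even k"
  shows "real ((n + k - 1) choose k) * m 1 ^ k \<le> fps_nth (Abs_fps m ^ n) k"
proof -
  have m0: "fps_nth (Abs_fps m) 0 = 1" using \<open>m 0 = 1\<close> by simp
  have "hankel_psd (simplex_moment m n)"
    using int m \<open>0 < n\<close> by (rule hankel_psd_simplex_moment)
  moreover have "simplex_moment m n 0 = 1" "simplex_moment m n 1 = m 1"
    using \<open>0 < n\<close> fps_power_nth_1[OF m0, of n] by (simp_all add: simplex_moment_def)
  ultimately have "m 1 ^ k \<le> simplex_moment m n k"
    using hankel_psd_even_ge_power[of "simplex_moment m n" "k div 2"] \<open>even k\<close> by simp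
  moreover have "0 < ((n + k - 1) choose k)"
    using \<open>0 < n\<close> by (simp add: zero_less_binomial_iff)
  ultimately show ?thesis
    by (simp add: simplex_moment_def pos_le_divide_eq mult.commute)
qed

section \<open>Symmetric kernels on a probability space\<close>

context prob_space
begin

text \<open>Bounds are required at every point, not almost everywhere, so that single sections and
  the diagonal of a function of two variables inherit them.\<close>

definition bounded_fun :: "('a \<Rightarrow> real) \<Rightarrow> bool" where
  "bounded_fun f \<longleftrightarrow> f \<in> borel_measurable M \<and> (\<exists>C. \<forall>x\<in>space M. \<bar>f x\<bar> \<le> C)"

definition bounded_fun2 :: "('a \<Rightarrow> 'a \<Rightarrow> real) \<Rightarrow> bool" where
  "bounded_fun2 f \<longleftrightarrow> case_prod f \<in> borel_measurable (M \<Otimes>\<^sub>M M) \<and>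
     (\<exists>C. \<forall>x\<in>space M. \<forall>y\<in>space M. \<bar>f x y\<bar> \<le> C)"

definition symmetric_kernel :: "('a \<Rightarrow> 'a \<Rightarrow> real) \<Rightarrow> bool" where
  "symmetric_kernel A \<longleftrightarrow> bounded_fun2 A \<and> (\<forall>x\<in>space M. \<forall>y\<in>space M. A x y = A y x)"

definition kernel_op :: "('a \<Rightarrow> 'a \<Rightarrow> real) \<Rightarrow> ('a \<Rightarrow> real) \<Rightarrow> 'a \<Rightarrow> real" where
  "kernel_op A f x = (\<integral>y. A x y * f y \<partial>M)"

definition kernel_moment :: "('a \<Rightarrow> 'a \<Rightarrow> real) \<Rightarrow> nat \<Rightarrow> real" where
  "kernel_moment A n = (\<integral>x. (kernel_op A ^^ n) (\<lambda>_. 1) x \<partial>M)"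

text \<open>The index is one less than the power of the operator whose trace is taken.\<close>

definition kernel_trace :: "('a \<Rightarrow> 'a \<Rightarrow> real) \<Rightarrow> nat \<Rightarrow> real" where
  "kernel_trace A n = (\<integral>x. (kernel_op A ^^ n) (A x) x \<partial>M)"

lemma bounded_fun_measurable: "bounded_fun f \<Longrightarrow> f \<in> borel_measurable M"
  by (simp add: bounded_fun_def)

lemma bounded_fun2_measurable: "bounded_fun2 f \<Longrightarrow> case_prod f \<in> borel_measurable (M \<Otimes>\<^sub>M M)"
  by (simp add: bounded_fun2_def)

lemma symmetric_kernel_bounded: "symmetric_kernel A \<Longrightarrow> bounded_fun2 A"
  by (simp add: symmetric_kernel_def)

lemma bounded_fun_integrable: "bounded_fun f \<Longrightarrow> integrable M f"
  unfolding bounded_fun_def by (metis AE_I2 integrable_const_bound real_norm_def)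

lemma bounded_fun_const: "bounded_fun (\<lambda>_. c)"
  unfolding bounded_fun_def by auto

lemma bounded_fun_mult:
  assumes "bounded_fun f" "bounded_fun g"
  shows "bounded_fun (\<lambda>x. f x * g x)"
proof -
  obtain C D where "\<forall>x\<in>space M. \<bar>f x\<bar> \<le> C" "\<forall>x\<in>space M. \<bar>g x\<bar> \<le> D"
    using assms by (auto simp: bounded_fun_def)
  then have "\<forall>x\<in>space M. \<bar>f x * g x\<bar> \<le> C * D"
    by (auto simp: abs_mult intro!: mult_mono intro: order_trans[OF abs_ge_zero])
  with assms show ?thesis
    unfolding bounded_fun_def by (auto intro!: borel_measurable_times)
qed

lemma bounded_fun_add:
  assumes "bounded_fun f" "bounded_fun g"
  shows "bounded_fun (\<lambda>x. f x + g x)"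
proof -
  obtain C D where "\<forall>x\<in>space M. \<bar>f x\<bar> \<le> C" "\<forall>x\<in>space M. \<bar>g x\<bar> \<le> D"
    using assms by (auto simp: bounded_fun_def)
  then have "\<forall>x\<in>space M. \<bar>f x + g x\<bar> \<le> C + D"
    by (meson abs_triangle_ineq add_mono order_trans)
  with assms show ?thesis
    unfolding bounded_fun_def by (auto intro!: borel_measurable_add)
qed

lemma bounded_fun2_const: "bounded_fun2 (\<lambda>_ _. c)"
  unfolding bounded_fun2_def by auto

lemma bounded_fun2_comp:
  assumes "bounded_fun2 f" and g: "continuous_on UNIV g"
  shows "bounded_fun2 (\<lambda>x y. g (f x y))"
proof -
  obtain C where C: "\<forall>x\<in>space M. \<forall>y\<in>space M. \<bar>f x y\<bar> \<le> C"
    using assms by (auto simp: bounded_fun2_def)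
  have "compact (g ` {-C..C})"
    using g by (intro compact_continuous_image) (auto intro: continuous_on_subset)
  then obtain D where "\<forall>t\<in>{-C..C}. \<bar>g t\<bar> \<le> D"
    by (metis bounded_iff compact_imp_bounded imageI real_norm_def)
  moreover have "f x y \<in> {-C..C}" if "x \<in> space M" "y \<in> space M" for x y
    using C that by (simp add: abs_le_iff minus_le_iff)
  ultimately have "\<forall>x\<in>space M. \<forall>y\<in>space M. \<bar>g (f x y)\<bar> \<le> D"
    by blast
  moreover have "(\<lambda>p. g (case_prod f p)) \<in> borel_measurable (M \<Otimes>\<^sub>M M)"
    using borel_measurable_continuous_onI[OF g] bounded_fun2_measurable[OF assms(1)]
    by (rule measurable_compose_rev)
  ultimately show ?thesis
    unfolding bounded_fun2_def by (auto simp: case_prod_beta)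
qed

lemma bounded_fun2_one_plus: "bounded_fun2 B \<Longrightarrow> bounded_fun2 (\<lambda>x y. 1 + B x y)"
  by (rule bounded_fun2_comp[where g = "\<lambda>t. 1 + t"]) (auto intro!: continuous_intros)

lemma symmetric_kernel_comp:
  assumes "symmetric_kernel A" "continuous_on UNIV g"
  shows "symmetric_kernel (\<lambda>x y. g (A x y))"
  using assms bounded_fun2_comp[of A g] by (auto simp: symmetric_kernel_def)

lemma bounded_fun2_section:
  assumes "bounded_fun2 f" "x \<in> space M"
  shows "bounded_fun (f x)"
proof -
  have "(\<lambda>y. case_prod f (x, y)) \<in> borel_measurable M"
    using assms by (intro measurable_compose[OF measurable_Pair1' bounded_fun2_measurable])
  then show ?thesis
    using assms unfolding bounded_fun_def bounded_fun2_def by auto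
qed

lemma bounded_fun2_diagonal:
  assumes "bounded_fun2 f"
  shows "bounded_fun (\<lambda>x. f x x)"
proof -
  have "(\<lambda>x. case_prod f (x, x)) \<in> borel_measurable M"
    using assms by (intro measurable_compose[OF _ bounded_fun2_measurable] measurable_Pair) auto
  then show ?thesis
    using assms unfolding bounded_fun_def bounded_fun2_def by auto
qed

lemma bounded_fun2_snd:
  assumes "bounded_fun f"
  shows "bounded_fun2 (\<lambda>_. f)"
  using assms measurable_compose[OF measurable_snd bounded_fun_measurable[OF assms], of M]
  unfolding bounded_fun_def bounded_fun2_def by (auto simp: case_prod_beta')

lemma bounded_fun2_fst:
  assumes "bounded_fun f"
  shows "bounded_fun2 (\<lambda>x _. f x)"
  using assms measurable_compose[OF measurable_fst bounded_fun_measurable[OF assms], of M]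
  unfolding bounded_fun_def bounded_fun2_def by (auto simp: case_prod_beta')

lemma bounded_fun2_mult:
  assumes "bounded_fun2 f" "bounded_fun2 g"
  shows "bounded_fun2 (\<lambda>x y. f x y * g x y)"
proof -
  obtain C D where "\<forall>x\<in>space M. \<forall>y\<in>space M. \<bar>f x y\<bar> \<le> C"
    and "\<forall>x\<in>space M. \<forall>y\<in>space M. \<bar>g x y\<bar> \<le> D"
    using assms by (auto simp: bounded_fun2_def)
  then have "\<forall>x\<in>space M. \<forall>y\<in>space M. \<bar>f x y * g x y\<bar> \<le> C * D"
    by (auto simp: abs_mult intro!: mult_mono intro: order_trans[OF abs_ge_zero])
  moreover have "(\<lambda>p. case_prod f p * case_prod g p) \<in> borel_measurable (M \<Otimes>\<^sub>M M)"
    using assms by (intro borel_measurable_times bounded_fun2_measurable)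
  ultimately show ?thesis
    unfolding bounded_fun2_def by (auto simp: case_prod_beta)
qed

lemma bounded_fun2_integrable:
  assumes "bounded_fun2 f"
  shows "integrable (M \<Otimes>\<^sub>M M) (\<lambda>(x, y). f x y)"
proof -
  interpret P: pair_prob_space M M ..
  obtain C where "\<forall>x\<in>space M. \<forall>y\<in>space M. \<bar>f x y\<bar> \<le> C"
    using assms by (auto simp: bounded_fun2_def)
  then have "AE p in M \<Otimes>\<^sub>M M. norm (case_prod f p) \<le> C"
    by (intro AE_I2) (auto simp: space_pair_measure)
  then show ?thesis
    by (rule P.integrable_const_bound[OF _ bounded_fun2_measurable[OF assms]])
qed

text \<open>The first variable is a parameter and the operator acts on the second. Joint
  measurability is what traces and path integrals need, since they evaluate on the diagonal.\<close>

lemma bounded_fun2_kernel_op: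
  assumes A: "bounded_fun2 A" and f: "bounded_fun2 f"
  shows "bounded_fun2 (\<lambda>x. kernel_op A (f x))"
proof -
  note [measurable] = bounded_fun2_measurable[OF A] bounded_fun2_measurable[OF f]
  obtain C D where C: "\<forall>x\<in>space M. \<forall>y\<in>space M. \<bar>A x y\<bar> \<le> C"
    and D: "\<forall>x\<in>space M. \<forall>y\<in>space M. \<bar>f x y\<bar> \<le> D"
    using assms by (auto simp: bounded_fun2_def)
  have "\<bar>kernel_op A (f x) y\<bar> \<le> C * D" if "x \<in> space M" "y \<in> space M" for x y
  proof -
    have prod: "bounded_fun (\<lambda>z. A y z * f x z)"
      using that A f by (intro bounded_fun_mult bounded_fun2_section)
    have "\<bar>kernel_op A (f x) y\<bar> \<le> (\<integral>z. \<bar>A y z * f x z\<bar> \<partial>M)"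
      unfolding kernel_op_def by (rule integral_abs_bound)
    also have "\<dots> \<le> C * D"
    proof (rule integral_le_const)
      show "AE z in M. \<bar>A y z * f x z\<bar> \<le> C * D"
        using C D that by (intro AE_I2)
          (auto simp: abs_mult intro!: mult_mono intro: order_trans[OF abs_ge_zero])
    qed (use bounded_fun_integrable[OF prod] in auto)
    finally show ?thesis .
  qed
  moreover have "case_prod (\<lambda>x. kernel_op A (f x)) \<in> borel_measurable (M \<Otimes>\<^sub>M M)"
    unfolding kernel_op_def by measurable
  ultimately show ?thesis
    unfolding bounded_fun2_def by blast
qed

lemma bounded_fun2_kernel_op_funpow:
  assumes "bounded_fun2 A" "bounded_fun2 f"
  shows "bounded_fun2 (\<lambda>x. (kernel_op A ^^ n) (f x))"
  by (induction n) (simp_all add: assms bounded_fun2_kernel_op)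

lemma bounded_fun_kernel_op_funpow:
  assumes A: "bounded_fun2 A" and f: "bounded_fun f"
  shows "bounded_fun ((kernel_op A ^^ n) f)"
proof -
  \<comment> \<open>The function is regarded as constant in a parameter, and the two-variable
    statement is read off at any one point.\<close>
  obtain x where "x \<in> space M" using not_empty by blast
  then show ?thesis
    using bounded_fun2_section[OF bounded_fun2_kernel_op_funpow[OF A bounded_fun2_snd[OF f]]] by simp
qed

lemma kernel_op_cong:
  assumes "\<And>y. y \<in> space M \<Longrightarrow> f y = g y"
  shows "kernel_op A f = kernel_op A g"
  unfolding kernel_op_def by (intro ext Bochner_Integration.integral_cong) (simp_all add: assms)

lemma kernel_op_add:
  assumes A: "bounded_fun2 A" and "bounded_fun f" "bounded_fun g" "x \<in> space M"
  shows "kernel_op A (\<lambda>y. f y + g y) x = kernel_op A f x + kernel_op A g x"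
  unfolding kernel_op_def distrib_left
  using assms by (intro Bochner_Integration.integral_add bounded_fun_integrable
      bounded_fun_mult bounded_fun2_section[OF A])

lemma kernel_op_scale: "kernel_op A (\<lambda>y. c * f y) x = c * kernel_op A f x"
  unfolding kernel_op_def by (simp add: mult.left_commute)

lemma kernel_op_sum:
  assumes A: "bounded_fun2 A" and "\<And>i. i \<in> I \<Longrightarrow> bounded_fun (f i)" "x \<in> space M"
  shows "kernel_op A (\<lambda>y. \<Sum>i\<in>I. c i * f i y) x = (\<Sum>i\<in>I. c i * kernel_op A (f i) x)"
proof -
  have "kernel_op A (\<lambda>y. \<Sum>i\<in>I. c i * f i y) x = (\<Sum>i\<in>I. \<integral>y. A x y * (c i * f i y) \<partial>M)"
    unfolding kernel_op_def sum_distrib_left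
    using assms by (intro Bochner_Integration.integral_sum bounded_fun_integrable
      bounded_fun_mult bounded_fun2_section[OF A] bounded_fun_const)
  then show ?thesis
    by (simp add: kernel_op_def mult.left_commute)
qed

lemma bounded_fun_sum:
  assumes "\<And>i. i \<in> I \<Longrightarrow> bounded_fun (f i)"
  shows "bounded_fun (\<lambda>x. \<Sum>i\<in>I. f i x)"
  using assms
  by (induction I rule: infinite_finite_induct) (simp_all add: bounded_fun_const bounded_fun_add)

lemma kernel_op_one_plus:
  assumes B: "bounded_fun2 B" and f: "bounded_fun f" and x: "x \<in> space M"
  shows "kernel_op (\<lambda>x y. 1 + B x y) f x = (\<integral>y. f y \<partial>M) + kernel_op B f x"
proof -
  have "integrable M (\<lambda>y. B x y * f y)"
    using assms by (intro bounded_fun_integrable bounded_fun_mult bounded_fun2_section[OF B])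
  then show ?thesis
    unfolding kernel_op_def distrib_right using bounded_fun_integrable[OF f] by simp
qed

section \<open>Self-adjointness and kernel moments\<close>

lemma kernel_op_self_adjoint:
  assumes A: "symmetric_kernel A" and f: "bounded_fun f" and g: "bounded_fun g"
  shows "(\<integral>x. f x * kernel_op A g x \<partial>M) = (\<integral>x. kernel_op A f x * g x \<partial>M)"
proof -
  interpret P: pair_prob_space M M ..
  have A2: "bounded_fun2 A" using A by (rule symmetric_kernel_bounded)
  have int: "integrable (M \<Otimes>\<^sub>M M) (\<lambda>(x, y). f x * (A x y * g y))"
    by (intro bounded_fun2_integrable bounded_fun2_mult bounded_fun2_fst bounded_fun2_snd A2 f g)
  have "(\<integral>x. f x * kernel_op A g x \<partial>M) = (\<integral>x. (\<integral>y. f x * (A x y * g y) \<partial>M) \<partial>M)"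
    by (simp add: kernel_op_def)
  also have "\<dots> = (\<integral>y. (\<integral>x. f x * (A x y * g y) \<partial>M) \<partial>M)"
    using P.Fubini_integral[OF int] by simp
  also have "\<dots> = (\<integral>y. (\<integral>x. (A y x * f x) * g y \<partial>M) \<partial>M)"
    using A by (intro Bochner_Integration.integral_cong refl) (simp add: symmetric_kernel_def mult_ac)
  also have "\<dots> = (\<integral>y. kernel_op A f y * g y \<partial>M)"
    by (simp add: kernel_op_def)
  finally show ?thesis .
qed

lemma kernel_op_funpow_self_adjoint:
  assumes A: "symmetric_kernel A" and f: "bounded_fun f" and g: "bounded_fun g"
  shows "(\<integral>x. f x * (kernel_op A ^^ n) g x \<partial>M) = (\<integral>x. (kernel_op A ^^ n) f x * g x \<partial>M)"
  using f
proof (induction n arbitrary: f)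
  case (Suc n)
  have A2: "bounded_fun2 A" using A by (rule symmetric_kernel_bounded)
  have "(\<integral>x. f x * (kernel_op A ^^ Suc n) g x \<partial>M) =
      (\<integral>x. kernel_op A f x * (kernel_op A ^^ n) g x \<partial>M)"
    using kernel_op_self_adjoint[OF A Suc.prems bounded_fun_kernel_op_funpow[OF A2 g]] by simp
  also have "\<dots> = (\<integral>x. (kernel_op A ^^ n) (kernel_op A f) x * g x \<partial>M)"
    using Suc.IH bounded_fun_kernel_op_funpow[OF A2 Suc.prems, of 1] by simp
  finally show ?case by (simp add: funpow_swap1)
qed simp

text \<open>This Gram representation stands in for the spectral measure: it is the hypothesis of
  \<open>even_nth_fps_power_ge\<close> with \<open>v i\<close> the i-th iterate of 1.\<close>

lemma kernel_moment_add:
  assumes A: "symmetric_kernel A"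
  shows "kernel_moment A (i + j) =
    (\<integral>x. (kernel_op A ^^ i) (\<lambda>_. 1) x * (kernel_op A ^^ j) (\<lambda>_. 1) x \<partial>M)"
proof -
  have "kernel_moment A (i + j) =
      (\<integral>x. 1 * (kernel_op A ^^ i) ((kernel_op A ^^ j) (\<lambda>_. 1)) x \<partial>M)"
    by (simp add: kernel_moment_def funpow_add)
  also have "\<dots> = (\<integral>x. (kernel_op A ^^ i) (\<lambda>_. 1) x * (kernel_op A ^^ j) (\<lambda>_. 1) x \<partial>M)"
    by (rule kernel_op_funpow_self_adjoint[OF A bounded_fun_const bounded_fun_kernel_op_funpow
        [OF symmetric_kernel_bounded[OF A] bounded_fun_const]])
  finally show ?thesis .
qed

lemma kernel_moment_0: "kernel_moment A 0 = 1"
  by (simp add: kernel_moment_def prob_space)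

lemma even_nth_kernel_moment_power_ge:
  assumes A: "symmetric_kernel A" and "0 < n" "even k"
  shows "real ((n + k - 1) choose k) * kernel_moment A 1 ^ k \<le> fps_nth (Abs_fps (kernel_moment A) ^ n) k"
proof (rule even_nth_fps_power_ge[where M = M and v = "\<lambda>i. (kernel_op A ^^ i) (\<lambda>_. 1)"])
  show "integrable M (\<lambda>x. (kernel_op A ^^ i) (\<lambda>_. 1) x * (kernel_op A ^^ j) (\<lambda>_. 1) x)" for i j
    by (intro bounded_fun_integrable bounded_fun_mult bounded_fun_kernel_op_funpow
        bounded_fun_const symmetric_kernel_bounded A)
qed (fact kernel_moment_add[OF A] kernel_moment_0 assms)+

text \<open>The two telescoping expansions of \<open>A\<^sup>n - B\<^sup>n\<close>, where \<open>A - B\<close> is the projection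
  onto the constants.\<close>

lemma kernel_op_one_plus_funpow:
  assumes B: "bounded_fun2 B" and g: "bounded_fun g" and x: "x \<in> space M"
  defines "A \<equiv> \<lambda>x y. 1 + B x y"
  shows "(kernel_op A ^^ n) g x = (kernel_op B ^^ n) g x +
    (\<Sum>i<n. (\<integral>y. (kernel_op A ^^ (n - 1 - i)) g y \<partial>M) * (kernel_op B ^^ i) (\<lambda>_. 1) x)"
  using x
proof (induction n arbitrary: x)
  case (Suc n)
  have A: "bounded_fun2 A"
    unfolding A_def using B by (rule bounded_fun2_one_plus)
  have one: "bounded_fun ((kernel_op B ^^ i) (\<lambda>_. 1))" for i
    by (intro bounded_fun_kernel_op_funpow B bounded_fun_const)
  let ?c = "\<lambda>i. \<integral>y. (kernel_op A ^^ (n - 1 - i)) g y \<partial>M"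
  have "(kernel_op A ^^ Suc n) g x =
      (\<integral>y. (kernel_op A ^^ n) g y \<partial>M) + kernel_op B ((kernel_op A ^^ n) g) x"
    using kernel_op_one_plus[OF B bounded_fun_kernel_op_funpow[OF A g] Suc.prems, folded A_def]
    by simp
  \<comment> \<open>The induction hypothesis holds only on the space of the measure, which suffices
    under the integral.\<close>
  also have "kernel_op B ((kernel_op A ^^ n) g) =
      kernel_op B (\<lambda>x. (kernel_op B ^^ n) g x + (\<Sum>i<n. ?c i * (kernel_op B ^^ i) (\<lambda>_. 1) x))"
    by (intro kernel_op_cong Suc.IH)
  also have "\<dots> x = kernel_op B ((kernel_op B ^^ n) g) x +
      (\<Sum>i<n. ?c i * kernel_op B ((kernel_op B ^^ i) (\<lambda>_. 1)) x)"
  proof -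
    have "bounded_fun (\<lambda>x. \<Sum>i<n. ?c i * (kernel_op B ^^ i) (\<lambda>_. 1) x)"
      by (intro bounded_fun_sum bounded_fun_mult bounded_fun_const one)
    then show ?thesis
      by (simp only: kernel_op_add[OF B bounded_fun_kernel_op_funpow[OF B g] _ Suc.prems]
          kernel_op_sum[OF B one Suc.prems])
  qed
  finally have "(kernel_op A ^^ Suc n) g x = (\<integral>y. (kernel_op A ^^ n) g y \<partial>M) +
      ((kernel_op B ^^ Suc n) g x + (\<Sum>i<n. ?c i * (kernel_op B ^^ Suc i) (\<lambda>_. 1) x))"
    by simp
  moreover have "(\<Sum>i<Suc n. (\<integral>y. (kernel_op A ^^ (Suc n - 1 - i)) g y \<partial>M) *
        (kernel_op B ^^ i) (\<lambda>_. 1) x) =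
      (\<integral>y. (kernel_op A ^^ n) g y \<partial>M) + (\<Sum>i<n. ?c i * (kernel_op B ^^ Suc i) (\<lambda>_. 1) x)"
    unfolding sum.lessThan_Suc_shift by simp
  ultimately show ?case
    by linarith
qed simp

lemma kernel_op_one_plus_funpow':
  assumes B: "bounded_fun2 B" and g: "bounded_fun g" and x: "x \<in> space M"
  defines "A \<equiv> \<lambda>x y. 1 + B x y"
  shows "(kernel_op A ^^ n) g x = (kernel_op B ^^ n) g x +
    (\<Sum>i<n. (\<integral>y. (kernel_op B ^^ (n - 1 - i)) g y \<partial>M) * (kernel_op A ^^ i) (\<lambda>_. 1) x)"
  using x
proof (induction n arbitrary: x)
  case (Suc n)
  have A: "bounded_fun2 A"
    unfolding A_def using B by (rule bounded_fun2_one_plus)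
  have one: "bounded_fun ((kernel_op A ^^ i) (\<lambda>_. 1))" for i
    by (intro bounded_fun_kernel_op_funpow A bounded_fun_const)
  let ?c = "\<lambda>i. \<integral>y. (kernel_op B ^^ (n - 1 - i)) g y \<partial>M"
  have "(kernel_op A ^^ Suc n) g x = kernel_op A ((kernel_op A ^^ n) g) x"
    by simp
  also have "kernel_op A ((kernel_op A ^^ n) g) =
      kernel_op A (\<lambda>x. (kernel_op B ^^ n) g x + (\<Sum>i<n. ?c i * (kernel_op A ^^ i) (\<lambda>_. 1) x))"
    by (intro kernel_op_cong Suc.IH)
  also have "\<dots> x = kernel_op A ((kernel_op B ^^ n) g) x +
      (\<Sum>i<n. ?c i * kernel_op A ((kernel_op A ^^ i) (\<lambda>_. 1)) x)"
  proof -
    have "bounded_fun (\<lambda>x. \<Sum>i<n. ?c i * (kernel_op A ^^ i) (\<lambda>_. 1) x)"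
      by (intro bounded_fun_sum bounded_fun_mult bounded_fun_const one)
    then show ?thesis
      by (simp only: kernel_op_add[OF A bounded_fun_kernel_op_funpow[OF B g] _ Suc.prems]
          kernel_op_sum[OF A one Suc.prems])
  qed
  also have "kernel_op A ((kernel_op B ^^ n) g) x =
      (\<integral>y. (kernel_op B ^^ n) g y \<partial>M) + kernel_op B ((kernel_op B ^^ n) g) x"
    unfolding A_def by (intro kernel_op_one_plus B bounded_fun_kernel_op_funpow g Suc.prems)
  finally have "(kernel_op A ^^ Suc n) g x = (\<integral>y. (kernel_op B ^^ n) g y \<partial>M) +
      (kernel_op B ^^ Suc n) g x + (\<Sum>i<n. ?c i * (kernel_op A ^^ Suc i) (\<lambda>_. 1) x)"
    by simp
  moreover have "(\<Sum>i<Suc n. (\<integral>y. (kernel_op B ^^ (Suc n - 1 - i)) g y \<partial>M) *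
        (kernel_op A ^^ i) (\<lambda>_. 1) x) =
      (\<integral>y. (kernel_op B ^^ n) g y \<partial>M) + (\<Sum>i<n. ?c i * (kernel_op A ^^ Suc i) (\<lambda>_. 1) x)"
    unfolding sum.lessThan_Suc_shift by simp
  ultimately show ?case
    by linarith
qed simp

text \<open>Integrating the first telescoping expansion at the constant 1 yields the recurrence
  solved by \<open>renewal_expansion\<close>.\<close>

lemma kernel_moment_one_plus:
  assumes B: "bounded_fun2 B"
  defines "A \<equiv> \<lambda>x y. 1 + B x y"
  shows "kernel_moment A n = kernel_moment B n +
    (\<Sum>i<n. kernel_moment A (n - 1 - i) * kernel_moment B i)"
proof -
  have one: "integrable M ((kernel_op B ^^ i) (\<lambda>_. 1))" for i
    by (intro bounded_fun_integrable bounded_fun_kernel_op_funpow B bounded_fun_const)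
  have "kernel_moment A n = (\<integral>x. (kernel_op B ^^ n) (\<lambda>_. 1) x +
      (\<Sum>i<n. kernel_moment A (n - 1 - i) * (kernel_op B ^^ i) (\<lambda>_. 1) x) \<partial>M)"
    unfolding kernel_moment_def A_def
    by (intro Bochner_Integration.integral_cong refl kernel_op_one_plus_funpow B bounded_fun_const)
  also have "\<dots> = kernel_moment B n + (\<Sum>i<n. kernel_moment A (n - 1 - i) * kernel_moment B i)"
    using one by (simp add: Bochner_Integration.integral_sum kernel_moment_def)
  finally show ?thesis .
qed

text \<open>Telescoping around the cycle: one factor of the power is replaced by the projection onto
  constants, which leaves the inner products of B^(n - i) 1 with A^i 1. The first telescoping
  expansion then resolves A^i 1 into powers of B.\<close>

lemma kernel_trace_one_plus:
  assumes B: "symmetric_kernel B"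
  defines "A \<equiv> \<lambda>x y. 1 + B x y"
  shows "kernel_trace A n = kernel_trace B n + (\<Sum>i\<le>n. kernel_moment B n +
    (\<Sum>r<i. kernel_moment A (i - 1 - r) * kernel_moment B (n - i + r)))"
proof -
  have B2: "bounded_fun2 B" using B by (rule symmetric_kernel_bounded)
  have A2: "bounded_fun2 A"
    unfolding A_def using B2 by (rule bounded_fun2_one_plus)
  define v where "v i = (kernel_op B ^^ i) (\<lambda>_. 1)" for i
  define w where "w i = (kernel_op A ^^ i) (\<lambda>_. 1)" for i
  have v: "bounded_fun (v i)" for i
    unfolding v_def by (intro bounded_fun_kernel_op_funpow B2 bounded_fun_const)
  have w: "bounded_fun (w i)" for i
    unfolding w_def by (intro bounded_fun_kernel_op_funpow A2 bounded_fun_const)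
  \<comment> \<open>By self-adjointness the integral pairs the j-th iterate of 1 with the section
    \<open>B x\<close>, which is one further application of the operator.\<close>
  have vint: "(\<integral>y. (kernel_op B ^^ j) (B x) y \<partial>M) = v (Suc j) x" if "x \<in> space M" for j x
    using kernel_op_funpow_self_adjoint[OF B bounded_fun_const bounded_fun2_section[OF B2 that], of 1 j]
    by (simp add: v_def kernel_op_def mult.commute)
  have "(kernel_op A ^^ n) (A x) x = (kernel_op B ^^ n) (B x) x + (\<Sum>i\<le>n. v (n - i) x * w i x)"
    if x: "x \<in> space M" for x
  proof -
    have Ax: "bounded_fun (A x)" and Bx: "bounded_fun (B x)"
      using A2 B2 x by (auto intro: bounded_fun2_section)
    have split: "(kernel_op B ^^ j) (A x) y = v j y + (kernel_op B ^^ j) (B x) y"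
      if "y \<in> space M" for j y
      using that
    proof (induction j arbitrary: y)
      case 0
      show ?case by (simp add: v_def A_def)
    next
      case (Suc j)
      have "(kernel_op B ^^ Suc j) (A x) y = kernel_op B ((kernel_op B ^^ j) (A x)) y" by simp
      also have "kernel_op B ((kernel_op B ^^ j) (A x)) =
          kernel_op B (\<lambda>y. v j y + (kernel_op B ^^ j) (B x) y)"
        by (intro kernel_op_cong Suc.IH)
      also have "\<dots> y = kernel_op B (v j) y + kernel_op B ((kernel_op B ^^ j) (B x)) y"
        by (intro kernel_op_add B2 v bounded_fun_kernel_op_funpow Bx Suc.prems)
      finally show ?case by (simp add: v_def)
    qed
    have "(\<integral>y. (kernel_op B ^^ j) (A x) y \<partial>M) = (\<integral>y. v j y \<partial>M) + v (Suc j) x" for j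
    proof -
      have "(\<integral>y. (kernel_op B ^^ j) (A x) y \<partial>M) = (\<integral>y. v j y + (kernel_op B ^^ j) (B x) y \<partial>M)"
        by (intro Bochner_Integration.integral_cong refl split)
      also have "\<dots> = (\<integral>y. v j y \<partial>M) + v (Suc j) x"
        by (simp add: vint[OF x] bounded_fun_integrable bounded_fun_kernel_op_funpow B2 Bx v)
      finally show ?thesis .
    qed
    then have "(kernel_op A ^^ n) (A x) x = v n x + (kernel_op B ^^ n) (B x) x +
        (\<Sum>i<n. ((\<integral>y. v (n - 1 - i) y \<partial>M) + v (Suc (n - 1 - i)) x) * w i x)"
      using kernel_op_one_plus_funpow'[OF B2 Ax x, of n, folded A_def]
      by (simp add: split[OF x] w_def)
    also have "\<dots> = (kernel_op B ^^ n) (B x) x +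
        (v n x + (\<Sum>i<n. (\<integral>y. v (n - 1 - i) y \<partial>M) * w i x)) + (\<Sum>i<n. v (n - i) x * w i x)"
      by (simp add: distrib_right sum.distrib Suc_diff_Suc)
    \<comment> \<open>The second expansion at the constant 1 collapses these terms into the summand
      i = n of the final sum, since \<open>v 0\<close> is 1.\<close>
    also have "v n x + (\<Sum>i<n. (\<integral>y. v (n - 1 - i) y \<partial>M) * w i x) = w n x"
      using kernel_op_one_plus_funpow'[OF B2 bounded_fun_const x, of n 1]
      by (simp add: v_def w_def A_def)
    finally show ?thesis
      by (simp add: lessThan_Suc_atMost[symmetric] v_def)
  qed
  then have "kernel_trace A n =
      (\<integral>x. (kernel_op B ^^ n) (B x) x + (\<Sum>i\<le>n. v (n - i) x * w i x) \<partial>M)"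
    unfolding kernel_trace_def by (intro Bochner_Integration.integral_cong refl)
  also have "\<dots> = kernel_trace B n + (\<Sum>i\<le>n. \<integral>x. v (n - i) x * w i x \<partial>M)"
    using bounded_fun2_diagonal[OF bounded_fun2_kernel_op_funpow[OF B2 B2], of n]
    by (simp add: Bochner_Integration.integral_sum bounded_fun_integrable bounded_fun_mult v w
        kernel_trace_def)
  also have "(\<integral>x. v (n - i) x * w i x \<partial>M) = kernel_moment B n +
      (\<Sum>r<i. kernel_moment A (i - 1 - r) * kernel_moment B (n - i + r))" if "i \<le> n" for i
  proof -
    have "(\<integral>x. v (n - i) x * w i x \<partial>M) = (\<integral>x. v (n - i) x * v i x +
        (\<Sum>r<i. kernel_moment A (i - 1 - r) * (v (n - i) x * v r x)) \<partial>M)"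
    proof (intro Bochner_Integration.integral_cong refl)
      fix x assume "x \<in> space M"
      then have "w i x = v i x + (\<Sum>r<i. kernel_moment A (i - 1 - r) * v r x)"
        unfolding w_def v_def kernel_moment_def A_def
        by (intro kernel_op_one_plus_funpow B2 bounded_fun_const)
      then show "v (n - i) x * w i x = v (n - i) x * v i x +
          (\<Sum>r<i. kernel_moment A (i - 1 - r) * (v (n - i) x * v r x))"
        by (simp add: distrib_left sum_distrib_left mult.left_commute)
    qed
    also have "\<dots> = (\<integral>x. v (n - i) x * v i x \<partial>M) +
        (\<Sum>r<i. kernel_moment A (i - 1 - r) * (\<integral>x. v (n - i) x * v r x \<partial>M))"
      by (simp add: Bochner_Integration.integral_sum bounded_fun_integrable bounded_fun_mult v)
    finally show ?thesis
      unfolding v_def kernel_moment_add[OF B, symmetric] using that by simp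
  qed
  then have "(\<Sum>i\<le>n. \<integral>x. v (n - i) x * w i x \<partial>M) = (\<Sum>i\<le>n. kernel_moment B n +
      (\<Sum>r<i. kernel_moment A (i - 1 - r) * kernel_moment B (n - i + r)))"
    by (intro sum.cong) auto
  finally show ?thesis .
qed

section \<open>Traces against moments, and integration along a path\<close>

lemma square_integral_le:
  assumes f: "bounded_fun f"
  shows "(\<integral>x. f x \<partial>M)\<^sup>2 \<le> (\<integral>x. f x * f x \<partial>M)"
proof -
  have "0 \<le> (\<integral>x. (f x - expectation f)\<^sup>2 \<partial>M)" by simp
  also have "\<dots> = (\<integral>x. (f x)\<^sup>2 \<partial>M) - (expectation f)\<^sup>2"
    using bounded_fun_integrable[OF bounded_fun_mult[OF f f]] bounded_fun_integrable[OF f]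
    by (intro variance_eq) (auto simp: power2_eq_square)
  finally show ?thesis by (simp add: power2_eq_square)
qed

text \<open>For g = B^l (B x), self-adjointness turns the diagonal value at x into the integral of
  g^2, and the integral of g into (B^(l + 1) 1)(x). Nonnegativity of the variance compares them
  pointwise in x. This handles the top degree of an even cycle.\<close>

lemma kernel_moment_le_kernel_trace:
  assumes B: "symmetric_kernel B"
  shows "kernel_moment B (2 * Suc l) \<le> kernel_trace B (Suc (2 * l))"
proof -
  have B2: "bounded_fun2 B" using B by (rule symmetric_kernel_bounded)
  define v where "v i = (kernel_op B ^^ i) (\<lambda>_. 1)" for i
  have v: "bounded_fun (v i)" for i
    unfolding v_def by (intro bounded_fun_kernel_op_funpow B2 bounded_fun_const)
  have "v (Suc l) x * v (Suc l) x \<le> (kernel_op B ^^ Suc (2 * l)) (B x) x" if x: "x \<in> space M" for x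
  proof -
    have Bx: "bounded_fun (B x)" using B2 x by (rule bounded_fun2_section)
    let ?g = "(kernel_op B ^^ l) (B x)"
    have g: "bounded_fun ?g" by (intro bounded_fun_kernel_op_funpow B2 Bx)
    have "(\<integral>y. 1 * ?g y \<partial>M) = (\<integral>y. v l y * B x y \<partial>M)"
      unfolding v_def by (intro kernel_op_funpow_self_adjoint B bounded_fun_const Bx)
    then have "(\<integral>y. ?g y \<partial>M) = v (Suc l) x"
      by (simp add: v_def kernel_op_def mult.commute)
    moreover have "(kernel_op B ^^ Suc (2 * l)) (B x) x = (\<integral>y. B x y * (kernel_op B ^^ l) ?g y \<partial>M)"
      by (simp add: kernel_op_def mult_2 funpow_add)
    moreover have "\<dots> = (\<integral>y. ?g y * ?g y \<partial>M)"
      by (rule kernel_op_funpow_self_adjoint[OF B Bx g])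
    ultimately show ?thesis
      using square_integral_le[OF g] by (simp add: power2_eq_square)
  qed
  then have "(\<integral>x. v (Suc l) x * v (Suc l) x \<partial>M) \<le> kernel_trace B (Suc (2 * l))"
    unfolding kernel_trace_def
    using bounded_fun2_diagonal[OF bounded_fun2_kernel_op_funpow[OF B2 B2]]
    by (intro integral_mono bounded_fun_integrable bounded_fun_mult v)
  then show ?thesis
    using kernel_moment_add[OF B, of "Suc l" "Suc l"] by (simp add: v_def mult_2)
qed

text \<open>Integrating out the last vertex applies the operator to \<open>f (x 0)\<close>. The
  factor \<open>f\<close> joins the two ends: the constant 1 leaves an open path, the kernel itself
  closes a cycle.\<close>

lemma integral_PiM_path:
  assumes A: "bounded_fun2 A" and f: "bounded_fun2 f"
  shows "(\<integral>x. (\<Prod>i<k. A (x i) (x (Suc i))) * f (x 0) (x k) \<partial>Pi\<^sub>M {..k} (\<lambda>_. M)) =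
    (\<integral>x. (kernel_op A ^^ k) (f x) x \<partial>M)"
  using f
proof (induction k arbitrary: f)
  case 0
  interpret product_sigma_finite "\<lambda>_. M" ..
  show ?case
    using product_integral_singleton[OF bounded_fun_measurable[OF bounded_fun2_diagonal[OF 0]], of 0]
    by (simp add: atMost_0)
next
  case (Suc k)
  interpret product_sigma_finite "\<lambda>_. M" ..
  interpret Q: prob_space "Pi\<^sub>M (insert (Suc k) {..k}) (\<lambda>_. M)"
    by (intro prob_space_PiM prob_space_axioms)
  note [measurable] = bounded_fun2_measurable[OF A] bounded_fun2_measurable[OF Suc.prems]
  obtain C D where C: "\<forall>x\<in>space M. \<forall>y\<in>space M. \<bar>A x y\<bar> \<le> C"
    and D: "\<forall>x\<in>space M. \<forall>y\<in>space M. \<bar>f x y\<bar> \<le> D"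
    using A Suc.prems by (auto simp: bounded_fun2_def)
  let ?F = "\<lambda>x. (\<Prod>i<Suc k. A (x i) (x (Suc i))) * f (x 0) (x (Suc k))"
  have int: "integrable (Pi\<^sub>M (insert (Suc k) {..k}) (\<lambda>_. M)) ?F"
  proof (rule Q.integrable_const_bound[where B = "C ^ Suc k * D"])
    have "\<bar>?F x\<bar> \<le> C ^ Suc k * D" if "x \<in> space (Pi\<^sub>M (insert (Suc k) {..k}) (\<lambda>_. M))" for x
    proof -
      have x: "x i \<in> space M" if "i \<le> Suc k" for i
        using \<open>x \<in> _\<close> that by (cases "i = Suc k") (auto simp: space_PiM PiE_iff)
      have "\<bar>\<Prod>i<Suc k. A (x i) (x (Suc i))\<bar> \<le> (\<Prod>i<Suc k. C)"
        unfolding abs_prod using x C by (intro prod_mono) auto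
      then show ?thesis
        unfolding abs_mult using x D by (intro mult_mono) (auto intro: order_trans[OF abs_ge_zero])
    qed
    then show "AE x in Pi\<^sub>M (insert (Suc k) {..k}) (\<lambda>_. M). norm (?F x) \<le> C ^ Suc k * D"
      by (intro AE_I2) simp
    have comp: "(\<lambda>x. case_prod g (x i, x j)) \<in> borel_measurable (Pi\<^sub>M (insert (Suc k) {..k}) (\<lambda>_. M))"
      if "bounded_fun2 g" "i \<le> Suc k" "j \<le> Suc k" for g i j
      using that by (intro measurable_compose[OF _ bounded_fun2_measurable] measurable_Pair
          measurable_component_singleton) (auto simp: le_Suc_eq)
    show "?F \<in> borel_measurable (Pi\<^sub>M (insert (Suc k) {..k}) (\<lambda>_. M))"
      using comp[OF A] comp[OF Suc.prems] by (intro borel_measurable_times borel_measurable_prod) auto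
  qed
  have "(\<integral>x. ?F x \<partial>Pi\<^sub>M {..Suc k} (\<lambda>_. M)) =
      (\<integral>x. (\<integral>y. ?F (x(Suc k := y)) \<partial>M) \<partial>Pi\<^sub>M {..k} (\<lambda>_. M))"
    unfolding atMost_Suc using int by (subst product_integral_insert) auto
  also have "\<dots> = (\<integral>x. (\<Prod>i<k. A (x i) (x (Suc i))) * kernel_op A (f (x 0)) (x k)
      \<partial>Pi\<^sub>M {..k} (\<lambda>_. M))"
    by (intro Bochner_Integration.integral_cong refl) (simp add: kernel_op_def mult.assoc)
  also have "\<dots> = (\<integral>x. (kernel_op A ^^ k) (kernel_op A (f x)) x \<partial>M)"
    by (intro Suc.IH bounded_fun2_kernel_op A Suc.prems)
  finally show ?case
    by (simp only: funpow_Suc_right comp_apply)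
qed

end

section \<open>Renewal expansions\<close>

lemma sum_triangle_lessThan:
  fixes g :: "nat \<Rightarrow> nat \<Rightarrow> 'a::comm_monoid_add"
  shows "(\<Sum>i<n. \<Sum>j\<le>n - 1 - i. g i j) = (\<Sum>k<n. \<Sum>i\<le>k. g i (k - i))"
proof -
  have "(\<Sum>i<n. \<Sum>j\<le>n - 1 - i. g i j) = (\<Sum>(i, j)\<in>{(i, j). i + j < n}. g i j)"
    by (subst sum.Sigma) (auto intro!: sum.cong)
  then show ?thesis by (simp add: sum.triangle_reindex)
qed

text \<open>Both sides list the ways of writing \<open>k + 1\<close> as a sum of positive integers, each
  part \<open>i + 1\<close> being weighted by \<open>m i\<close>.\<close>

lemma renewal_expansion:
  fixes m F :: "nat \<Rightarrow> 'a::comm_ring_1"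
  assumes F: "\<And>k. F k = m k + (\<Sum>i<k. F (k - 1 - i) * m i)"
  shows "F k = (\<Sum>j\<le>k. fps_nth (Abs_fps m ^ (k - j + 1)) j)"
proof (induction k rule: less_induct)
  case (less k)
  let ?H = "Abs_fps m"
  have "(\<Sum>i<k. F (k - 1 - i) * m i) =
      (\<Sum>i<k. \<Sum>j\<le>k - 1 - i. m i * fps_nth (?H ^ (k - (i + j))) j)"
  proof (intro sum.cong refl)
    fix i assume i: "i \<in> {..<k}"
    have "F (k - 1 - i) = (\<Sum>j\<le>k - 1 - i. fps_nth (?H ^ (k - 1 - i - j + 1)) j)"
      using i by (intro less.IH) auto
    also have "\<dots> = (\<Sum>j\<le>k - 1 - i. fps_nth (?H ^ (k - (i + j))) j)"
    proof (intro sum.cong refl)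
      fix j assume "j \<in> {..k - 1 - i}"
      then have "k - 1 - i - j + 1 = k - (i + j)" using i by auto
      then show "fps_nth (?H ^ (k - 1 - i - j + 1)) j = fps_nth (?H ^ (k - (i + j))) j" by simp
    qed
    finally show "F (k - 1 - i) * m i = (\<Sum>j\<le>k - 1 - i. m i * fps_nth (?H ^ (k - (i + j))) j)"
      by (simp add: sum_distrib_left mult.commute)
  qed
  also have "\<dots> = (\<Sum>t<k. \<Sum>i\<le>t. m i * fps_nth (?H ^ (k - (i + (t - i)))) (t - i))"
    by (rule sum_triangle_lessThan)
  also have "\<dots> = (\<Sum>t<k. fps_nth (?H ^ (k - t + 1)) t)"
    by (intro sum.cong refl) (auto simp: fps_mult_nth atMost_atLeast0 intro!: sum.cong)
  finally show ?case
    by (subst F) (simp add: lessThan_Suc_atMost[symmetric])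
qed

text \<open>The weights r + 1 turn f into f + X f', and (n + 1) f' f^n is the derivative of f^(n +
  1), which contributes k times its k-th coefficient.\<close>

lemma fps_power_weighted_convolution:
  fixes f :: "'a::comm_ring_1 fps"
  shows "of_nat (Suc n) * (\<Sum>r\<le>k. of_nat (Suc r) * fps_nth f r * fps_nth (f ^ n) (k - r)) =
    of_nat (Suc n + k) * fps_nth (f ^ Suc n) k"
proof -
  have "(\<Sum>r\<le>k. of_nat (Suc r) * fps_nth f r * fps_nth (f ^ n) (k - r)) =
      fps_nth ((f + fps_X * fps_deriv f) * f ^ n) k"
    unfolding fps_mult_nth[of _ "f ^ n"] atMost_atLeast0
    by (intro sum.cong refl) (simp add: fps_X_mult_nth distrib_right)
  also have "\<dots> = fps_nth (f ^ Suc n) k + fps_nth (fps_X * (fps_deriv f * f ^ n)) k"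
    by (simp add: distrib_right mult.assoc)
  finally have "of_nat (Suc n) * (\<Sum>r\<le>k. of_nat (Suc r) * fps_nth f r * fps_nth (f ^ n) (k - r)) =
      of_nat (Suc n) * fps_nth (f ^ Suc n) k +
      fps_nth (fps_X * (of_nat (Suc n) * (fps_deriv f * f ^ n))) k"
    by (simp add: distrib_left mult.left_commute[of fps_X] fps_of_nat[symmetric] del: of_nat_Suc)
  also have "of_nat (Suc n) * (fps_deriv f * f ^ n) = fps_deriv (f ^ Suc n)"
    unfolding fps_deriv_power by (simp add: fps_of_nat mult.assoc del: of_nat_Suc)
  also have "fps_nth (fps_X * fps_deriv (f ^ Suc n)) k = of_nat k * fps_nth (f ^ Suc n) k"
    by (cases k) (simp_all add: fps_X_mult_nth del: power_Suc)
  finally show ?thesis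
    by (simp add: distrib_right)
qed

text \<open>Cyclic analogue of \<open>renewal_expansion\<close>: the arc through a marked place of
  the cycle, of length r + 1, can be positioned in r + 1 ways, and the rest is a linear composition.
  The weighted convolution converts these positions into the prefactor. The summands
  \<open>m n\<close> are the n + 1 positions of a single arc, matching k = n.\<close>

lemma cyclic_renewal_expansion:
  fixes m F :: "nat \<Rightarrow> 'a::field_char_0"
  assumes F: "\<And>k. F k = m k + (\<Sum>i<k. F (k - 1 - i) * m i)"
  shows "(\<Sum>i\<le>n. m n + (\<Sum>r<i. F (i - 1 - r) * m (n - i + r))) =
    (\<Sum>k\<le>n. of_nat (Suc n) / of_nat (Suc n - k) * fps_nth (Abs_fps m ^ (Suc n - k)) k)"
proof -
  let ?H = "Abs_fps m"
  have "(\<Sum>i\<le>n. \<Sum>r<i. F (i - 1 - r) * m (n - i + r)) = (\<Sum>i\<le>n. \<Sum>c<i. F c * m (n - 1 - c))"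
  proof (rule sum.cong[OF refl])
    fix i assume "i \<in> {..n}"
    then have "(\<Sum>r<i. F (i - 1 - r) * m (n - i + r)) =
        (\<Sum>r<i. F (i - Suc r) * m (n - 1 - (i - Suc r)))"
      by (intro sum.cong refl arg_cong2[where f = "(*)"] arg_cong[where f = m]
          arg_cong[where f = F]) auto
    then show "(\<Sum>r<i. F (i - 1 - r) * m (n - i + r)) = (\<Sum>c<i. F c * m (n - 1 - c))"
      by (simp only: sum.nat_diff_reindex[of "\<lambda>c. F c * m (n - 1 - c)"])
  qed
  also have "\<dots> = (\<Sum>c<n. of_nat (n - c) * (F c * m (n - 1 - c)))"
    by (simp add: sum.nested_swap')
  \<comment> \<open>Reversal of the sum, with r = n - 1 - c, so that the marked arc has length r +
    1.\<close>
  also have "\<dots> = (\<Sum>r<n. of_nat (n - (n - Suc r)) * (F (n - Suc r) * m (n - 1 - (n - Suc r))))"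
    by (rule sum.nat_diff_reindex[symmetric])
  also have "\<dots> = (\<Sum>r<n. \<Sum>j\<le>n - 1 - r. of_nat (Suc r) * m r * fps_nth (?H ^ (n - (r + j))) j)"
  proof (intro sum.cong refl)
    fix r assume r: "r \<in> {..<n}"
    have "F (n - Suc r) = (\<Sum>j\<le>n - 1 - r. fps_nth (?H ^ (n - Suc r - j + 1)) j)"
      using renewal_expansion[OF F, of "n - Suc r"] by simp
    also have "\<dots> = (\<Sum>j\<le>n - 1 - r. fps_nth (?H ^ (n - (r + j))) j)"
    proof (intro sum.cong refl)
      fix j assume "j \<in> {..n - 1 - r}"
      then have "n - Suc r - j + 1 = n - (r + j)" using r by auto
      then show "fps_nth (?H ^ (n - Suc r - j + 1)) j = fps_nth (?H ^ (n - (r + j))) j" by simp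
    qed
    finally have *: "F (n - Suc r) = (\<Sum>j\<le>n - 1 - r. fps_nth (?H ^ (n - (r + j))) j)" .
    have "n - (n - Suc r) = Suc r" "n - 1 - (n - Suc r) = r"
      using r by auto
    then show "of_nat (n - (n - Suc r)) * (F (n - Suc r) * m (n - 1 - (n - Suc r))) =
        (\<Sum>j\<le>n - 1 - r. of_nat (Suc r) * m r * fps_nth (?H ^ (n - (r + j))) j)"
      by (simp only: * sum_distrib_left mult_ac)
  qed
  also have "\<dots> = (\<Sum>k<n. \<Sum>r\<le>k. of_nat (Suc r) * m r * fps_nth (?H ^ (n - (r + (k - r)))) (k - r))"
    by (rule sum_triangle_lessThan)
  also have "\<dots> = (\<Sum>k<n. of_nat (Suc n) / of_nat (Suc n - k) * fps_nth (?H ^ (Suc n - k)) k)"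
  proof (intro sum.cong refl)
    fix k assume k: "k \<in> {..<n}"
    then have eq: "Suc (n - k) = Suc n - k" "Suc (n - k) + k = Suc n" by auto
    have "(\<Sum>r\<le>k. of_nat (Suc r) * m r * fps_nth (?H ^ (n - (r + (k - r)))) (k - r)) =
        (\<Sum>r\<le>k. of_nat (Suc r) * fps_nth ?H r * fps_nth (?H ^ (n - k)) (k - r))"
      by (intro sum.cong refl) simp
    also have "\<dots> = of_nat (Suc n) / of_nat (Suc n - k) * fps_nth (?H ^ (Suc n - k)) k"
      using fps_power_weighted_convolution[of "n - k" ?H k] k unfolding eq
      by (simp add: field_simps del: of_nat_Suc power_Suc)
    finally show "(\<Sum>r\<le>k. of_nat (Suc r) * m r * fps_nth (?H ^ (n - (r + (k - r)))) (k - r)) =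
        of_nat (Suc n) / of_nat (Suc n - k) * fps_nth (?H ^ (Suc n - k)) k" .
  qed
  finally show ?thesis
    by (simp add: sum.distrib lessThan_Suc_atMost[symmetric])
qed

text \<open>The substitution of -y for y in the series, which corresponds to passing from U to
  -U.\<close>

lemma fps_nth_power_alternating:
  fixes m :: "nat \<Rightarrow> 'a::comm_ring_1"
  shows "fps_nth (Abs_fps (\<lambda>i. (-1) ^ i * m i) ^ n) k = (-1) ^ k * fps_nth (Abs_fps m ^ n) k"
proof (induction n arbitrary: k)
  case (Suc n)
  show ?case
    unfolding power_Suc fps_mult_nth sum_distrib_left
  proof (intro sum.cong refl)
    fix i assume "i \<in> {0..k}"
    then have "(-1::'a) ^ k = (-1) ^ i * (-1) ^ (k - i)"
      by (simp add: power_add[symmetric])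
    then show "fps_nth (Abs_fps (\<lambda>i. (-1) ^ i * m i)) i *
        fps_nth (Abs_fps (\<lambda>i. (-1) ^ i * m i) ^ n) (k - i) =
        (-1) ^ k * (fps_nth (Abs_fps m) i * fps_nth (Abs_fps m ^ n) (k - i))"
      unfolding Suc.IH fps_nth_Abs_fps by (simp add: mult_ac)
  qed
qed (simp add: fps_one_nth)

lemma fps_power_nth_2:
  fixes f :: "real fps"
  assumes "fps_nth f 0 = 1"
  shows "fps_nth (f ^ n) 2 = real n * fps_nth f 2 + real n * (real n - 1) / 2 * (fps_nth f 1)\<^sup>2"
proof (induction n)
  case (Suc n)
  have "fps_nth (f ^ Suc n) 2 =
      fps_nth (f ^ n) 2 + fps_nth f 1 * fps_nth (f ^ n) 1 + fps_nth f 2 * fps_nth (f ^ n) 0"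
    by (simp add: fps_mult_nth numeral_2_eq_2 assms)
  then show ?case
    unfolding Suc.IH fps_power_nth_1[OF assms] by (simp add: power2_eq_square field_simps)
qed (simp add: fps_one_nth)

text \<open>Odd degrees cancel, and each even degree enters twice with a nonnegative excess over its
  binomial share. Discarding every excess except that of degree 2 gives the bound.\<close>

lemma second_coefficient_gap:
  fixes s :: "nat \<Rightarrow> real"
  assumes ge: "\<And>j. j \<le> e \<Longrightarrow> even j \<Longrightarrow> real (e choose j) * p ^ j \<le> s j"
    and "2 \<le> e"
    and le: "(\<Sum>j\<le>e. s j) + (\<Sum>j\<le>e. (-1) ^ j * s j) \<le> (1 + p) ^ e + (1 - p) ^ e + 2 * \<epsilon>"
  shows "s 2 - real (e choose 2) * p\<^sup>2 \<le> \<epsilon>"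
proof -
  let ?d = "\<lambda>j. (1 + (-1) ^ j) * (s j - real (e choose j) * p ^ j)"
  have "(1 + p) ^ e = (\<Sum>j\<le>e. real (e choose j) * p ^ j)"
    using binomial_ring[of p 1 e] by (simp add: add.commute)
  moreover have "(1 - p) ^ e = (\<Sum>j\<le>e. (-1) ^ j * (real (e choose j) * p ^ j))"
    using binomial_ring[of "- p" 1 e] by (simp add: power_minus[of p] mult_ac)
  ultimately have "(\<Sum>j\<le>e. ?d j) = (\<Sum>j\<le>e. s j) + (\<Sum>j\<le>e. (-1) ^ j * s j) - ((1 + p) ^ e + (1 - p) ^ e)"
    by (simp add: algebra_simps sum.distrib sum_subtractf)
  moreover have "?d 2 \<le> (\<Sum>j\<le>e. ?d j)"
  proof (rule member_le_sum)
    fix j assume "j \<in> {..e} - {2}"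
    then show "0 \<le> ?d j"
      using ge[of j] by (cases "even j") auto
  qed (use \<open>2 \<le> e\<close> in auto)
  ultimately show ?thesis
    using le by simp
qed

context prob_space
begin

lemma kernel_op_scale_kernel_funpow:

  \<comment> \<open>Homogeneity, and the excess in degree 2 for paths and cycles\<close>
  "(kernel_op (\<lambda>x y. c * A x y) ^^ n) f = (\<lambda>x. c ^ n * (kernel_op A ^^ n) f x)"
proof (induction n)
  case (Suc n)
  have "(kernel_op (\<lambda>x y. c * A x y) ^^ Suc n) f =
      kernel_op (\<lambda>x y. c * A x y) (\<lambda>x. c ^ n * (kernel_op A ^^ n) f x)"
    by (simp only: funpow.simps comp_apply Suc)
  also have "\<dots> = (\<lambda>x. c ^ Suc n * kernel_op A ((kernel_op A ^^ n) f) x)"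
    by (rule ext) (simp only: kernel_op_scale, simp add: kernel_op_def mult.assoc)
  finally show ?case by simp
qed simp

lemma kernel_moment_scale: "kernel_moment (\<lambda>x y. c * A x y) n = c ^ n * kernel_moment A n"
  by (simp add: kernel_moment_def kernel_op_scale_kernel_funpow)

lemma kernel_trace_scale: "kernel_trace (\<lambda>x y. c * A x y) n = c ^ Suc n * kernel_trace A n"
proof -
  have "(kernel_op A ^^ n) (\<lambda>y. c * A x y) = (\<lambda>y. c * (kernel_op A ^^ n) (A x) y)" for x
  proof (induction n)
    case (Suc n)
    show ?case
      by (simp only: funpow.simps comp_apply Suc) (rule ext, simp add: kernel_op_scale)
  qed simp
  then show ?thesis
    by (simp add: kernel_trace_def kernel_op_scale_kernel_funpow)
qed

lemma kernel_moment_uminus: "kernel_moment (\<lambda>x y. - U x y) n = (-1) ^ n * kernel_moment U n"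
  using kernel_moment_scale[of "-1" U n] by simp

lemma kernel_trace_uminus: "kernel_trace (\<lambda>x y. - U x y) n = (-1) ^ Suc n * kernel_trace U n"
  using kernel_trace_scale[of "-1" U n] by simp

text \<open>Using U on j edges of the path and 1 on the others leaves e - j + 1 segments, hence the
  exponent in \<open>s\<close>. In degree 2 the coefficient of the squared mean is (e - 1)(e - 2)/2
  - e(e - 1)/2 = -(e - 1), which is why the gap appears with the factor e - 1.\<close>

lemma kernel_moment_gap:
  assumes U: "symmetric_kernel U" and e: "2 \<le> e"
    and le: "kernel_moment (\<lambda>x y. 1 + U x y) e + kernel_moment (\<lambda>x y. 1 - U x y) e
      \<le> (1 + kernel_moment U 1) ^ e + (1 - kernel_moment U 1) ^ e + 2 * \<epsilon>"
  shows "(real e - 1) * (kernel_moment U 2 - (kernel_moment U 1)\<^sup>2) \<le> \<epsilon>"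
proof -
  define s where "s j = fps_nth (Abs_fps (kernel_moment U) ^ (e - j + 1)) j" for j
  have U2: "bounded_fun2 U" using U by (rule symmetric_kernel_bounded)
  have U2': "bounded_fun2 (\<lambda>x y. - U x y)"
    by (rule bounded_fun2_comp[OF U2]) (auto intro: continuous_intros)
  have "kernel_moment (\<lambda>x y. 1 + U x y) e = (\<Sum>j\<le>e. s j)"
    unfolding s_def by (rule renewal_expansion[OF kernel_moment_one_plus[OF U2]])
  moreover have "kernel_moment (\<lambda>x y. 1 - U x y) e = (\<Sum>j\<le>e. (-1) ^ j * s j)"
    using renewal_expansion[OF kernel_moment_one_plus[OF U2'], of e]
    unfolding kernel_moment_uminus[abs_def] fps_nth_power_alternating s_def by simp
  ultimately have sum: "(\<Sum>j\<le>e. s j) + (\<Sum>j\<le>e. (-1) ^ j * s j)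
      \<le> (1 + kernel_moment U 1) ^ e + (1 - kernel_moment U 1) ^ e + 2 * \<epsilon>"
    using le by simp
  have "s 2 - real (e choose 2) * (kernel_moment U 1)\<^sup>2 \<le> \<epsilon>"
  proof (rule second_coefficient_gap[OF _ e sum])
    fix j assume "j \<le> e" "even j"
    then show "real (e choose j) * kernel_moment U 1 ^ j \<le> s j"
      using even_nth_kernel_moment_power_ge[OF U, of "e - j + 1" j] by (simp add: s_def)
  qed
  moreover have "s 2 = (real e - 1) * kernel_moment U 2 +
      (real e - 1) * (real e - 2) / 2 * (kernel_moment U 1)\<^sup>2"
    unfolding s_def using e by (subst fps_power_nth_2) (simp_all add: kernel_moment_0 of_nat_diff)
  moreover have "real (e choose 2) = real e * (real e - 1) / 2"
    using e by (simp add: choose_two real_of_nat_div of_nat_diff)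
  ultimately show ?thesis
    by (simp add: field_simps)
qed

text \<open>Here n + 1 is the length of the cycle. Degrees up to n come from cutting it into arcs,
  while degree n + 1 is the trace itself. The degree 2 excess carries n + 1, one more than the n
  obtained for a path of the same length.\<close>

lemma kernel_trace_gap:
  assumes U: "symmetric_kernel U" and n: "2 \<le> n"
    and le: "kernel_trace (\<lambda>x y. 1 + U x y) n + kernel_trace (\<lambda>x y. 1 - U x y) n
      \<le> (1 + kernel_moment U 1) ^ Suc n + (1 - kernel_moment U 1) ^ Suc n + 2 * \<epsilon>"
  shows "(real n + 1) * (kernel_moment U 2 - (kernel_moment U 1)\<^sup>2) \<le> \<epsilon>"
proof -
  define s where "s j = (if j \<le> n then
      real (Suc n) / real (Suc n - j) * fps_nth (Abs_fps (kernel_moment U) ^ (Suc n - j)) j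
    else kernel_trace U n)" for j
  have U2: "bounded_fun2 U" using U by (rule symmetric_kernel_bounded)
  have U': "symmetric_kernel (\<lambda>x y. - U x y)"
    by (rule symmetric_kernel_comp[OF U]) (auto intro: continuous_intros)
  have U2': "bounded_fun2 (\<lambda>x y. - U x y)" using U' by (rule symmetric_kernel_bounded)
  have "kernel_trace (\<lambda>x y. 1 + U x y) n = (\<Sum>j\<le>Suc n. s j)"
    unfolding kernel_trace_one_plus[OF U] cyclic_renewal_expansion[OF kernel_moment_one_plus[OF U2]]
    by (simp add: s_def add.commute)
  moreover have "kernel_trace (\<lambda>x y. 1 - U x y) n = (\<Sum>j\<le>Suc n. (-1) ^ j * s j)"
    using kernel_trace_one_plus[OF U', of n]
    unfolding cyclic_renewal_expansion[OF kernel_moment_one_plus[OF U2']]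
    by (simp add: kernel_moment_uminus[abs_def] kernel_trace_uminus fps_nth_power_alternating s_def
        add.commute mult.left_commute)
  ultimately have sum: "(\<Sum>j\<le>Suc n. s j) + (\<Sum>j\<le>Suc n. (-1) ^ j * s j)
      \<le> (1 + kernel_moment U 1) ^ Suc n + (1 - kernel_moment U 1) ^ Suc n + 2 * \<epsilon>"
    using le by simp
  have "s 2 - real (Suc n choose 2) * (kernel_moment U 1)\<^sup>2 \<le> \<epsilon>"
  proof (rule second_coefficient_gap[OF _ _ sum])
    fix j assume j: "j \<le> Suc n" "even j"
    show "real (Suc n choose j) * kernel_moment U 1 ^ j \<le> s j"
    proof (cases "j \<le> n")
      case True
      \<comment> \<open>The cyclic prefactor is exactly the ratio of the binomial share in n + 1
        edges to the bound for n + 1 - j arcs.\<close>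
      have "(Suc n - j) * (Suc n choose j) = Suc n * (n choose j)"
        using binomial_absorb_comp[of "Suc n" j] by simp
      then have "real (Suc n - j) * real (Suc n choose j) = real (Suc n) * real (n choose j)"
        by (metis of_nat_mult)
      then have "real (Suc n choose j) = real (Suc n) / real (Suc n - j) * real (n choose j)"
        using True by (simp add: field_simps del: of_nat_Suc)
      moreover have "real (n choose j) * kernel_moment U 1 ^ j \<le>
          fps_nth (Abs_fps (kernel_moment U) ^ (Suc n - j)) j"
        using even_nth_kernel_moment_power_ge[OF U, of "Suc n - j" j] True j by simp
      then have "real (Suc n) / real (Suc n - j) * (real (n choose j) * kernel_moment U 1 ^ j) \<le>
          real (Suc n) / real (Suc n - j) * fps_nth (Abs_fps (kernel_moment U) ^ (Suc n - j)) j"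
        by (rule mult_left_mono) simp
      ultimately show ?thesis
        using True by (simp only: s_def mult.assoc if_True)
    next
      case False
      \<comment> \<open>In the top degree the path moment is interposed: Jensen below it, the trace
        above it.\<close>
      with j have "j = Suc n" by simp
      with j obtain l where l: "n = Suc (2 * l)"
        by (metis even_Suc oddE Suc_eq_plus1)
      have "kernel_moment U 1 ^ j \<le> kernel_moment U j"
        using even_nth_kernel_moment_power_ge[OF U, of 1 j] j by simp
      also have "\<dots> \<le> kernel_trace U n"
        using kernel_moment_le_kernel_trace[OF U, of l] by (simp add: \<open>j = Suc n\<close> l)
      finally show ?thesis
        by (simp add: s_def \<open>j = Suc n\<close>)
    qed
  qed (use n in simp)
  moreover have "s 2 = (real n + 1) * kernel_moment U 2 +
      (real n + 1) * (real n - 2) / 2 * (kernel_moment U 1)\<^sup>2"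
    unfolding s_def using n
    by (subst fps_power_nth_2) (simp_all add: kernel_moment_0 of_nat_diff field_simps)
  moreover have "real (Suc n choose 2) = real (Suc n) * real n / 2"
    by (simp add: choose_two real_of_nat_div algebra_simps)
  ultimately show ?thesis
    by (simp add: field_simps)
qed

end

section \<open>Homomorphism densities of paths and cycles\<close>

text \<open>Used to pull null sets of the square back to the cube along an edge. Distinct indices
  matter: equal ones would concentrate the image on the diagonal.\<close>

lemma (in prob_space) distr_PiM_pair:
  assumes S: "finite S" "i \<in> S" "j \<in> S" "i \<noteq> j"
  shows "distr (Pi\<^sub>M S (\<lambda>_. M)) (M \<Otimes>\<^sub>M M) (\<lambda>x. (x i, x j)) = M \<Otimes>\<^sub>M M"
proof (rule pair_measure_eqI[symmetric])
  interpret product_sigma_finite "\<lambda>_. M" ..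
  have meas: "(\<lambda>x. (x i, x j)) \<in> Pi\<^sub>M S (\<lambda>_. M) \<rightarrow>\<^sub>M M \<Otimes>\<^sub>M M"
    using S by (intro measurable_Pair measurable_component_singleton)
  fix A B assume AB: "A \<in> sets M" "B \<in> sets M"
  let ?E = "\<lambda>k. if k = i then A else if k = j then B else space M"
  have "(\<lambda>x. (x i, x j)) -` (A \<times> B) \<inter> space (Pi\<^sub>M S (\<lambda>_. M)) = Pi\<^sub>E S ?E"
    using S AB[THEN sets.sets_into_space]
    by (auto simp: space_PiM PiE_iff split: if_splits) (metis subsetD)
  then have "emeasure (distr (Pi\<^sub>M S (\<lambda>_. M)) (M \<Otimes>\<^sub>M M) (\<lambda>x. (x i, x j))) (A \<times> B) =
      (\<Prod>k\<in>S. emeasure M (?E k))"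
    using AB S by (simp add: emeasure_distr[OF meas] emeasure_PiM)
  also have "\<dots> = emeasure M A * (emeasure M B * (\<Prod>k\<in>S - {i} - {j}. emeasure M (?E k)))"
    using S by (subst prod.remove[of _ i], simp, simp, subst prod.remove[of _ j]) auto
  also have "(\<Prod>k\<in>S - {i} - {j}. emeasure M (?E k)) = 1"
    by (intro prod.neutral) (auto simp: emeasure_space_1)
  finally show "emeasure M A * emeasure M B =
      emeasure (distr (Pi\<^sub>M S (\<lambda>_. M)) (M \<Otimes>\<^sub>M M) (\<lambda>x. (x i, x j))) (A \<times> B)"
    by simp
qed (simp_all add: sigma_finite_measure_axioms)

section \<open>From Lebesgue measurable to Borel kernels\<close>

lemma measurable_completion_AE_cong:
  assumes g: "g \<in> M \<rightarrow>\<^sub>M N" and f: "\<And>x. x \<in> space M \<Longrightarrow> f x \<in> space N"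
    and eq: "AE x in M. f x = g x"
  shows "f \<in> completion M \<rightarrow>\<^sub>M N"
proof (rule measurableI)
  fix A assume A: "A \<in> sets N"
  show "f -` A \<inter> space (completion M) \<in> sets (completion M)"
  proof (rule completion.in_sets_AE)
    show "g -` A \<inter> space (completion M) \<in> sets (completion M)"
      using measurable_completion[OF g] A by (rule measurable_sets)
    show "AE x in completion M. x \<in> g -` A \<inter> space (completion M) \<longleftrightarrow>
        x \<in> f -` A \<inter> space (completion M)"
      using AE_completion[OF eq] by eventually_elim auto
  qed auto
qed (use f in auto)

lemma integral_completion_AE_cong:
  fixes f g :: "'a \<Rightarrow> 'b::{banach, second_countable_topology}"
  assumes g: "g \<in> borel_measurable M" and eq: "AE x in M. f x = g x"
  shows "integral\<^sup>L (completion M) f = integral\<^sup>L M g"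
proof -
  have "integral\<^sup>L (completion M) f = integral\<^sup>L (completion M) g"
    using measurable_completion_AE_cong[OF g _ eq] measurable_completion[OF g] AE_completion[OF eq]
    by (intro integral_cong_AE) auto
  then show ?thesis using integral_completion[OF g] by simp
qed

abbreviation unit_lborel :: "real measure" where
  "unit_lborel \<equiv> restrict_space lborel {0..1}"

interpretation unit: prob_space unit_lborel
  by (rule prob_space_restrict_space) auto

lemma unit_lborel_AE_pair:
  assumes "AE p in lborel. P p"
  shows "AE x in unit_lborel. AE y in unit_lborel. P (x, y)"
proof -
  have "AE x in lborel. AE y in lborel. P (x, y)"
    using assms unfolding lborel_prod[symmetric] by (rule lborel_pair.AE_pair)
  then show ?thesis
    by (simp add: AE_restrict_space_iff)
      (auto elim!: eventually_mono)
qed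

text \<open>A Borel function equal to \<open>W\<close> almost everywhere need be neither symmetric
  nor bounded. Sorting the arguments restores exact symmetry, and clamping at the bound of
  \<open>W\<close> restores boundedness everywhere.\<close>

lemma kernel_borel_version:
  assumes W: "is_kernel W"
  obtains V where "unit.symmetric_kernel V"
    and "AE p in unit_lborel \<Otimes>\<^sub>M unit_lborel. W (fst p) (snd p) = V (fst p) (snd p)"
proof -
  interpret P: pair_prob_space unit_lborel unit_lborel ..
  let ?S = "{0..1::real} \<times> {0..1::real}"
  have sym: "W x y = W y x" if "x \<in> {0..1}" "y \<in> {0..1}" for x y
    using W that by (auto simp: is_kernel_def)
  obtain C where C: "\<bar>W x y\<bar> \<le> C" if "x \<in> {0..1}" "y \<in> {0..1}" for x y
    using W by (force simp: is_kernel_def bounded_iff)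
  have "?S \<in> sets lebesgue"
    by (intro borel_closed[THEN sets_completionI_sets[of _ lborel, simplified]] closed_Times) auto
  then have "(\<lambda>p. if p \<in> ?S then case_prod W p else 0) \<in> borel_measurable lebesgue"
    using W by (subst borel_measurable_if) (auto simp: is_kernel_def)
  then obtain g where g[measurable]: "g \<in> borel_measurable lborel"
    and "AE p in lborel. (if p \<in> ?S then case_prod W p else 0) = g p"
    using completion_ex_borel_measurable_real by blast
  then obtain N where N: "N \<in> null_sets lborel"
    and "{p. (if p \<in> ?S then case_prod W p else 0) \<noteq> g p} \<subseteq> N"
    unfolding eventually_ae_filter by auto
  then have WN: "(if p \<in> ?S then case_prod W p else 0) = g p" if "p \<notin> N" for p
    using that by blast
  define V where "V x y = max (- C) (min C (g (min x y, max x y)))" for x y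
  have pair: "(\<lambda>p. (fst p, snd p)) \<in> unit_lborel \<Otimes>\<^sub>M unit_lborel \<rightarrow>\<^sub>M (lborel :: (real \<times> real) measure)"
  proof -
    have id: "(\<lambda>x. x) \<in> unit_lborel \<rightarrow>\<^sub>M (lborel :: real measure)"
      by (rule measurable_restrict_space1[OF measurable_ident_sets[OF refl]])
    have "(\<lambda>p. fst p) \<in> unit_lborel \<Otimes>\<^sub>M unit_lborel \<rightarrow>\<^sub>M (lborel :: real measure)"
      by (rule measurable_compose[OF measurable_fst id])
    moreover have "(\<lambda>p. snd p) \<in> unit_lborel \<Otimes>\<^sub>M unit_lborel \<rightarrow>\<^sub>M (lborel :: real measure)"
      by (rule measurable_compose[OF measurable_snd id])
    ultimately have "(\<lambda>p. (fst p, snd p)) \<in> unit_lborel \<Otimes>\<^sub>M unit_lborel \<rightarrow>\<^sub>M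
        (lborel :: real measure) \<Otimes>\<^sub>M (lborel :: real measure)"
      by (rule measurable_Pair)
    then show ?thesis
      by (simp only: lborel_prod)
  qed
  have V: "unit.symmetric_kernel V"
    unfolding unit.symmetric_kernel_def unit.bounded_fun2_def
  proof (intro conjI)
    show "case_prod V \<in> borel_measurable (unit_lborel \<Otimes>\<^sub>M unit_lborel)"
    proof -
      have sort: "(\<lambda>p :: real \<times> real. (min (fst p) (snd p), max (fst p) (snd p))) \<in> lborel \<rightarrow>\<^sub>M lborel"
        unfolding measurable_lborel1 measurable_lborel2
        by (intro borel_measurable_continuous_onI continuous_intros)
      have [measurable]: "(\<lambda>p. g (min (fst p) (snd p), max (fst p) (snd p))) \<in>
          borel_measurable (unit_lborel \<Otimes>\<^sub>M unit_lborel)"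
        using measurable_compose[OF measurable_compose[OF pair sort] g]
        unfolding fst_conv snd_conv .
      show ?thesis
        unfolding V_def case_prod_beta' by measurable
    qed
    show "\<exists>C. \<forall>x\<in>space unit_lborel. \<forall>y\<in>space unit_lborel. \<bar>V x y\<bar> \<le> C"
      by (rule exI[of _ "\<bar>C\<bar>"]) (auto simp: V_def abs_if min_def max_def)
    show "\<forall>x\<in>space unit_lborel. \<forall>y\<in>space unit_lborel. V x y = V y x"
      by (simp add: V_def min.commute max.commute)
  qed
  have "AE p in lborel. p \<notin> N"
    using N by (rule AE_not_in)
  then have AE1: "AE x in unit_lborel. AE y in unit_lborel. (x, y) \<notin> N"
    by (rule unit_lborel_AE_pair)
  have "{p \<in> space (unit_lborel \<Otimes>\<^sub>M unit_lborel). (fst p, snd p) \<notin> N}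
      \<in> sets (unit_lborel \<Otimes>\<^sub>M unit_lborel)"
  proof -
    have "- N \<in> sets lborel" using N by (auto simp: null_sets_def)
    then show ?thesis using measurable_sets[OF pair, of "- N"]
      by (simp add: vimage_def Int_def conj_commute)
  qed
  note mN = this
  \<comment> \<open>Sorting may read \<open>g\<close> at (y, x) instead of (x, y), so the
    exceptional set and its reflection must both be avoided.\<close>
  have AE2: "AE x in unit_lborel. AE y in unit_lborel. (y, x) \<notin> N"
    using P.AE_commute[of "\<lambda>x y. (x, y) \<notin> N", OF mN] AE1 by simp
  have "AE p in unit_lborel \<Otimes>\<^sub>M unit_lborel. (fst p, snd p) \<notin> N \<and> (snd p, fst p) \<notin> N"
  proof (rule AE_conjI)
    show "AE p in unit_lborel \<Otimes>\<^sub>M unit_lborel. (fst p, snd p) \<notin> N"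
      by (rule P.AE_pair_measure[OF mN]) (use AE1 in simp)
    have "{p \<in> space (unit_lborel \<Otimes>\<^sub>M unit_lborel). (snd p, fst p) \<notin> N} =
        (\<lambda>(x, y). (y, x)) -` {p \<in> space (unit_lborel \<Otimes>\<^sub>M unit_lborel). (fst p, snd p) \<notin> N}
          \<inter> space (unit_lborel \<Otimes>\<^sub>M unit_lborel)"
      by (auto simp: space_pair_measure)
    also have "\<dots> \<in> sets (unit_lborel \<Otimes>\<^sub>M unit_lborel)"
      by (rule measurable_sets[OF measurable_pair_swap' mN])
    finally have "{p \<in> space (unit_lborel \<Otimes>\<^sub>M unit_lborel). (snd p, fst p) \<notin> N}
        \<in> sets (unit_lborel \<Otimes>\<^sub>M unit_lborel)" .
    then show "AE p in unit_lborel \<Otimes>\<^sub>M unit_lborel. (snd p, fst p) \<notin> N"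
      by (rule P.AE_pair_measure) (use AE2 in simp)
  qed
  then have "AE p in unit_lborel \<Otimes>\<^sub>M unit_lborel. W (fst p) (snd p) = V (fst p) (snd p)"
  proof (rule AE_mp, intro AE_I2 impI)
    fix p assume p: "p \<in> space (unit_lborel \<Otimes>\<^sub>M unit_lborel)"
      and nN: "(fst p, snd p) \<notin> N \<and> (snd p, fst p) \<notin> N"
    obtain x y where [simp]: "p = (x, y)" by (cases p)
    have xy: "x \<in> {0..1}" "y \<in> {0..1}" using p by (auto simp: space_pair_measure)
    have "g (min x y, max x y) = W x y"
      using WN[of "(x, y)"] WN[of "(y, x)"] nN xy sym[OF xy] by (auto simp: min_def max_def)
    then show "W (fst p) (snd p) = V (fst p) (snd p)"
      using C[OF xy] by (simp add: V_def abs_le_iff)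
  qed
  with V show ?thesis by (rule that)
qed

text \<open>Only symmetry at the given pair is assumed, so this also serves the Borel
  versions.\<close>

lemma edge_weight_eq:
  assumes "W (x i) (x j) = W (x j) (x i)"
  shows "edge_weight W x {i, j} = W (x i) (x j)"
  unfolding edge_weight_def
proof (rule the_equality)
  fix r assume "\<exists>i' j'. {i, j} = {i', j'} \<and> r = W (x i') (x j')"
  then show "r = W (x i) (x j)"
    using assms by (auto simp: doubleton_eq_iff)
qed blast

lemma simple_graph_edgeE:
  assumes "simple_graph F" "e \<in> edges F"
  obtains i j where "e = {i, j}" "i \<in> verts F" "j \<in> verts F" "i \<noteq> j"
  using assms by (auto simp: simple_graph_def card_2_iff)

lemma simple_graph_finite_edges: "simple_graph F \<Longrightarrow> finite (edges F)"
  by (rule finite_subset[of _ "Pow (verts F)"]) (auto simp: simple_graph_def)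

lemma unit_kernel_edge_weight:
  assumes "unit.symmetric_kernel V" "x i \<in> {0..1}" "x j \<in> {0..1}"
  shows "edge_weight V x {i, j} = V (x i) (x j)"
  using assms by (intro edge_weight_eq) (auto simp: unit.symmetric_kernel_def)

lemma measurable_edge_weight:
  assumes V: "unit.symmetric_kernel V" and F: "simple_graph F" "e \<in> edges F"
  shows "(\<lambda>x. edge_weight V x e) \<in> borel_measurable (Pi\<^sub>M (verts F) (\<lambda>_. unit_lborel))"
proof -
  obtain i j where ij: "e = {i, j}" "i \<in> verts F" "j \<in> verts F"
    using F by (rule simple_graph_edgeE)
  have "(\<lambda>x. case_prod V (x i, x j)) \<in> borel_measurable (Pi\<^sub>M (verts F) (\<lambda>_. unit_lborel))"
    using ij by (intro measurable_compose[OF _ unit.bounded_fun2_measurable] measurable_Pair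
        measurable_component_singleton unit.symmetric_kernel_bounded V)
  then show ?thesis
    by (rule measurable_cong[THEN iffD1, rotated])
      (use ij in \<open>auto simp: space_PiM PiE_iff unit_kernel_edge_weight[OF V]\<close>)
qed

text \<open>Leaving out the completion makes Fubini on finite products directly applicable.\<close>

definition borel_hom_density :: "'v graph \<Rightarrow> (real \<Rightarrow> real \<Rightarrow> real) \<Rightarrow> real" where
  "borel_hom_density F V =
    (\<integral>x. (\<Prod>e\<in>edges F. edge_weight V x e) \<partial>Pi\<^sub>M (verts F) (\<lambda>_. unit_lborel))"

text \<open>An edge joins two distinct coordinates, whose joint law is the measure on the square, so
  its weights agree almost everywhere; finitely many edges give one null set.\<close>

lemma hom_density_eq_borel_hom_density:
  assumes F: "simple_graph F" and W: "is_kernel W" and V: "unit.symmetric_kernel V"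
    and eq: "AE p in unit_lborel \<Otimes>\<^sub>M unit_lborel. W (fst p) (snd p) = V (fst p) (snd p)"
  shows "hom_density F W = borel_hom_density F V"
  unfolding hom_density_def borel_hom_density_def
proof (rule integral_completion_AE_cong)
  show "(\<lambda>x. \<Prod>e\<in>edges F. edge_weight V x e) \<in> borel_measurable (Pi\<^sub>M (verts F) (\<lambda>_. unit_lborel))"
    by (intro borel_measurable_prod measurable_edge_weight V F)
  have fin: "finite (verts F)" using F by (simp add: simple_graph_def)
  have "AE x in Pi\<^sub>M (verts F) (\<lambda>_. unit_lborel). edge_weight W x e = edge_weight V x e"
    if e: "e \<in> edges F" for e
  proof -
    obtain i j where ij: "e = {i, j}" "i \<in> verts F" "j \<in> verts F" "i \<noteq> j"
      using F e by (rule simple_graph_edgeE)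
    have "AE x in Pi\<^sub>M (verts F) (\<lambda>_. unit_lborel). W (x i) (x j) = V (x i) (x j)"
    proof -
      have "(\<lambda>x. (x i, x j)) \<in> Pi\<^sub>M (verts F) (\<lambda>_. unit_lborel) \<rightarrow>\<^sub>M unit_lborel \<Otimes>\<^sub>M unit_lborel"
        using ij by (intro measurable_Pair measurable_component_singleton)
      from AE_distrD[OF this, of "\<lambda>p. W (fst p) (snd p) = V (fst p) (snd p)"]
      show ?thesis
        unfolding unit.distr_PiM_pair[OF fin ij(2-4)] using eq by simp
    qed
    then show ?thesis
    proof (rule AE_mp, intro AE_I2 impI)
      fix x assume "x \<in> space (Pi\<^sub>M (verts F) (\<lambda>_. unit_lborel))" "W (x i) (x j) = V (x i) (x j)"
      then show "edge_weight W x e = edge_weight V x e"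
        using ij edge_weight_doubleton[OF W, of x i j] unit_kernel_edge_weight[OF V, of x i j]
        by (auto simp: space_PiM PiE_iff)
    qed
  qed
  then have "AE x in Pi\<^sub>M (verts F) (\<lambda>_. unit_lborel). \<forall>e\<in>edges F. edge_weight W x e = edge_weight V x e"
    by (intro AE_finite_allI simple_graph_finite_edges F)
  then show "AE x in Pi\<^sub>M (verts F) (\<lambda>_. unit_lborel).
      (\<Prod>e\<in>edges F. edge_weight W x e) = (\<Prod>e\<in>edges F. edge_weight V x e)"
    by eventually_elim (intro prod.cong, auto)
qed


section \<open>Invariance under graph isomorphism\<close>

lemma graph_iso_bij_betw_edges:
  assumes F: "simple_graph F" and G: "simple_graph G"
    and f: "bij_betw f (verts F) (verts G)"
    and iso: "\<And>i j. i \<in> verts F \<Longrightarrow> j \<in> verts F \<Longrightarrow> {i, j} \<in> edges F \<longleftrightarrow> {f i, f j} \<in> edges G"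
  shows "bij_betw ((`) f) (edges F) (edges G)"
  unfolding bij_betw_def
proof (intro conjI equalityI subsetI)
  have "inj_on ((`) f) (Pow (verts F))"
    using f by (simp add: bij_betw_def inj_on_image_Pow)
  then show "inj_on ((`) f) (edges F)"
    by (rule inj_on_subset) (use F in \<open>auto simp: simple_graph_def\<close>)
next
  fix e' assume "e' \<in> (`) f ` edges F"
  then obtain e where e: "e \<in> edges F" "e' = f ` e" by blast
  from F e(1) obtain i j where "e = {i, j}" "i \<in> verts F" "j \<in> verts F" "i \<noteq> j"
    by (rule simple_graph_edgeE)
  then show "e' \<in> edges G"
    using e iso[of i j] by (metis image_empty image_insert)
next
  fix e' assume e': "e' \<in> edges G"
  with G obtain a b where ab: "e' = {a, b}" "a \<in> verts G" "b \<in> verts G" "a \<noteq> b"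
    by (rule simple_graph_edgeE)
  from ab(2,3) have "a \<in> f ` verts F" "b \<in> f ` verts F"
    by (simp_all only: bij_betw_imp_surj_on[OF f])
  then obtain i j where ij: "i \<in> verts F" "j \<in> verts F" "a = f i" "b = f j"
    by (elim imageE)
  have "{f i, f j} \<in> edges G"
    using e' unfolding ab(1) ij(3,4) .
  then have "{i, j} \<in> edges F"
    using iso[OF ij(1,2)] by (rule iffD2[rotated])
  moreover have "e' = f ` {i, j}"
    unfolding ab(1) ij(3,4) by simp
  ultimately show "e' \<in> (`) f ` edges F" by blast
qed

lemma graph_iso_num_edges:
  assumes "simple_graph F" "simple_graph G" "graph_iso F G"
  shows "num_edges F = num_edges G"
proof -
  from assms(3) obtain f where "bij_betw f (verts F) (verts G)"
    and "\<And>i j. i \<in> verts F \<Longrightarrow> j \<in> verts F \<Longrightarrow> {i, j} \<in> edges F \<longleftrightarrow> {f i, f j} \<in> edges G"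
    unfolding graph_iso_def by blast
  then have "bij_betw ((`) f) (edges F) (edges G)"
    by (rule graph_iso_bij_betw_edges[OF assms(1,2)])
  then show ?thesis
    unfolding num_edges_def by (rule bij_betw_same_card)
qed

text \<open>Relabelling coordinates along the bijection preserves the product measure and permutes
  the edge factors.\<close>

lemma graph_iso_borel_hom_density:
  assumes V: "unit.symmetric_kernel V" and F: "simple_graph F" and G: "simple_graph G"
    and iso: "graph_iso F G"
  shows "borel_hom_density F V = borel_hom_density G V"
proof -
  let ?P = "\<lambda>S. Pi\<^sub>M S (\<lambda>_. unit_lborel)"
  from iso obtain f where f: "bij_betw f (verts F) (verts G)"
    and edge: "\<And>i j. i \<in> verts F \<Longrightarrow> j \<in> verts F \<Longrightarrow> {i, j} \<in> edges F \<longleftrightarrow> {f i, f j} \<in> edges G"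
    unfolding graph_iso_def by blast
  have into: "f i \<in> verts G" if "i \<in> verts F" for i
    using f that by (auto simp: bij_betw_def)
  let ?r = "\<lambda>y. \<lambda>i\<in>verts F. y (f i)"
  have r: "?r \<in> ?P (verts G) \<rightarrow>\<^sub>M ?P (verts F)"
    by (intro measurable_restrict measurable_component_singleton into)
  have "distr (?P (verts G)) (?P (verts F)) ?r = ?P (verts F)"
    by (rule distr_PiM_reindex[where M = "\<lambda>_. unit_lborel"])
      (use f in \<open>auto simp: bij_betw_def unit.prob_space_axioms\<close>)
  then have "borel_hom_density F V =
      (\<integral>x. (\<Prod>e\<in>edges F. edge_weight V x e) \<partial>distr (?P (verts G)) (?P (verts F)) ?r)"
    by (simp add: borel_hom_density_def)
  also have "\<dots> = (\<integral>y. (\<Prod>e\<in>edges F. edge_weight V (?r y) e) \<partial>?P (verts G))"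
    by (intro integral_distr r borel_measurable_prod measurable_edge_weight V F)
  also have "\<dots> = (\<integral>y. (\<Prod>e\<in>edges G. edge_weight V y e) \<partial>?P (verts G))"
  proof (rule Bochner_Integration.integral_cong[OF refl])
    fix y assume y: "y \<in> space (?P (verts G))"
    have "(\<Prod>e\<in>edges F. edge_weight V (?r y) e) = (\<Prod>e\<in>edges F. edge_weight V y (f ` e))"
    proof (rule prod.cong[OF refl])
      fix e assume "e \<in> edges F"
      with F obtain i j where "e = {i, j}" "i \<in> verts F" "j \<in> verts F" "i \<noteq> j"
        by (rule simple_graph_edgeE)
      then show "edge_weight V (?r y) e = edge_weight V y (f ` e)"
        using y into[of i] into[of j] unit_kernel_edge_weight[OF V, of "?r y" i j]
          unit_kernel_edge_weight[OF V, of y "f i" "f j"]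
        by (auto simp: space_PiM PiE_iff)
    qed
    also have "\<dots> = (\<Prod>e\<in>edges G. edge_weight V y e)"
      by (rule prod.reindex_bij_betw[OF graph_iso_bij_betw_edges[OF F G f edge]])
    finally show "(\<Prod>e\<in>edges F. edge_weight V (?r y) e) = (\<Prod>e\<in>edges G. edge_weight V y e)" .
  qed
  finally show ?thesis by (simp add: borel_hom_density_def)
qed

section \<open>The standard paths and cycles\<close>

lemma simple_path_graph: "simple_graph (path_graph k)"
  by (auto simp: simple_graph_def path_graph_def)

lemma path_graph_edges: "edges (path_graph k) = (\<lambda>i. {i, Suc i}) ` {..<k}"
  by (auto simp: path_graph_def)

lemma inj_path_edge: "inj_on (\<lambda>i. {i, Suc i}) A"
  by (auto simp: inj_on_def doubleton_eq_iff)

lemma num_edges_path_graph: "num_edges (path_graph k) = k"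
  by (simp add: num_edges_def path_graph_edges card_image inj_path_edge)

lemma cycle_graph_edges: "edges (cycle_graph k) = (\<lambda>i. {i, Suc i mod k}) ` {..<k}"
  by (auto simp: cycle_graph_def)

lemma Suc_mod_eq: "i < k \<Longrightarrow> Suc i mod k = (if Suc i = k then 0 else Suc i)" for i k :: nat
  by auto

lemma simple_cycle_graph: "3 \<le> k \<Longrightarrow> simple_graph (cycle_graph k)"
  by (auto simp: simple_graph_def cycle_graph_edges Suc_mod_eq) (auto simp: cycle_graph_def)

text \<open>For k = 2 both indices would give the same unordered edge.\<close>

lemma inj_cycle_edge: "3 \<le> k \<Longrightarrow> inj_on (\<lambda>i. {i, Suc i mod k}) {..<k}"
  by (auto simp: inj_on_def doubleton_eq_iff Suc_mod_eq split: if_splits)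

lemma num_edges_cycle_graph: "3 \<le> k \<Longrightarrow> num_edges (cycle_graph k) = k"
  by (simp add: num_edges_def cycle_graph_edges card_image inj_cycle_edge)

lemma borel_hom_density_path_graph:
  assumes V: "unit.symmetric_kernel V"
  shows "borel_hom_density (path_graph k) V = unit.kernel_moment V k"
proof -
  have "borel_hom_density (path_graph k) V =
      (\<integral>x. (\<Prod>i<k. V (x i) (x (Suc i))) * 1 \<partial>Pi\<^sub>M {..k} (\<lambda>_. unit_lborel))"
    unfolding borel_hom_density_def path_graph_edges
  proof (rule Bochner_Integration.integral_cong)
    fix x assume "x \<in> space (Pi\<^sub>M {..k} (\<lambda>_. unit_lborel))"
    then have x: "x i \<in> {0..1}" if "i \<le> k" for i
      using that by (auto simp: space_PiM PiE_iff)
    show "(\<Prod>e\<in>(\<lambda>i. {i, Suc i}) ` {..<k}. edge_weight V x e) = (\<Prod>i<k. V (x i) (x (Suc i))) * 1"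
      unfolding prod.reindex[OF inj_path_edge]
      by (auto intro!: prod.cong unit_kernel_edge_weight[OF V] x simp del: atLeastAtMost_iff)
  qed (simp add: path_graph_def)
  also have "\<dots> = unit.kernel_moment V k"
    unfolding unit.kernel_moment_def
    by (rule unit.integral_PiM_path[OF unit.symmetric_kernel_bounded[OF V] unit.bounded_fun2_const])
  finally show ?thesis .
qed

lemma borel_hom_density_cycle_graph:
  assumes V: "unit.symmetric_kernel V" and n: "2 \<le> n"
  shows "borel_hom_density (cycle_graph (Suc n)) V = unit.kernel_trace V n"
proof -
  have "borel_hom_density (cycle_graph (Suc n)) V =
      (\<integral>x. (\<Prod>i<n. V (x i) (x (Suc i))) * V (x 0) (x n) \<partial>Pi\<^sub>M {..n} (\<lambda>_. unit_lborel))"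
    unfolding borel_hom_density_def cycle_graph_edges
  proof (rule Bochner_Integration.integral_cong)
    fix x assume "x \<in> space (Pi\<^sub>M {..n} (\<lambda>_. unit_lborel))"
    then have x: "x i \<in> {0..1}" if "i \<le> n" for i
      using that by (auto simp: space_PiM PiE_iff)
    have inj: "inj_on (\<lambda>i. {i, Suc i mod Suc n}) {..<Suc n}"
      using n by (intro inj_cycle_edge) simp
    have "(\<Prod>e\<in>(\<lambda>i. {i, Suc i mod Suc n}) ` {..<Suc n}. edge_weight V x e) =
        (\<Prod>i<n. edge_weight V x {i, Suc i}) * edge_weight V x {n, 0}"
      unfolding prod.reindex[OF inj] by simp
    also have "(\<Prod>i<n. edge_weight V x {i, Suc i}) = (\<Prod>i<n. V (x i) (x (Suc i)))"
      by (auto intro!: prod.cong unit_kernel_edge_weight[OF V] x simp del: atLeastAtMost_iff)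
    also have "edge_weight V x {n, 0} = V (x 0) (x n)"
      using unit_kernel_edge_weight[OF V, of x 0 n] x by (simp add: insert_commute)
    finally show "(\<Prod>e\<in>(\<lambda>i. {i, Suc i mod Suc n}) ` {..<Suc n}. edge_weight V x e) =
        (\<Prod>i<n. V (x i) (x (Suc i))) * V (x 0) (x n)" .
  qed (simp add: cycle_graph_def lessThan_Suc_atMost)
  also have "\<dots> = unit.kernel_trace V n"
    unfolding unit.kernel_trace_def
    using unit.symmetric_kernel_bounded[OF V] by (intro unit.integral_PiM_path)
  finally show ?thesis .
qed

lemma complete_graph_2: "complete_graph 2 = path_graph 1"
proof -
  have "{{i, j} | i j. i < 2 \<and> j < 2 \<and> i \<noteq> j} = {{0, 1::nat}}"
    by (auto simp: less_2_cases_iff)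
  moreover have "{..<2} = {..1::nat}" by auto
  ultimately show ?thesis
    by (simp add: complete_graph_def path_graph_def)
qed

section \<open>Affine changes of kernel and the conclusion\<close>

lemma is_kernel_affine:
  assumes W: "is_kernel W"
  shows "is_kernel (\<lambda>x y. a + b * W x y)"
  unfolding is_kernel_def
proof (intro conjI)
  let ?S = "{0..1::real} \<times> {0..1::real}"
  have "(\<lambda>(x, y). a + b * W x y) ` ?S = (\<lambda>t. a + t) ` (\<lambda>t. b *\<^sub>R t) ` (\<lambda>(x, y). W x y) ` ?S"
    by (simp add: image_image case_prod_beta')
  then show "bounded ((\<lambda>(x, y). a + b * W x y) ` ?S)"
    using W by (simp only: bounded_translation bounded_scaling is_kernel_def)
  show "(\<lambda>(x, y). a + b * W x y) \<in> borel_measurable (lebesgue_on ?S)"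
    using W unfolding is_kernel_def case_prod_beta'
    by (intro borel_measurable_add borel_measurable_times) auto
qed (use W in \<open>simp add: is_kernel_def\<close>)

theorem theorem4p2:
  fixes H :: "'v graph" and W :: "real \<Rightarrow> real \<Rightarrow> real" and \<epsilon> :: real
  assumes "(is_path H \<and> num_edges H \<ge> 2) \<or> is_cycle H"
    and "is_kernel W"
    and "\<epsilon> \<ge> 0"
    and "hom_density H W + hom_density H (\<lambda>x y. 1 - W x y)
      \<le> hom_density (complete_graph 2) W ^ num_edges H
        + hom_density (complete_graph 2) (\<lambda>x y. 1 - W x y) ^ num_edges H
        + 2 powi (1 - int (num_edges H)) * \<epsilon>"
  shows "hom_density (path_graph 2) (\<lambda>x y. 2 * W x y - 1)
      \<le> hom_density (complete_graph 2) (\<lambda>x y. 2 * W x y - 1) ^ 2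
        + \<epsilon> / (real (num_edges H) - 1)"
proof -
  obtain V where V: "unit.symmetric_kernel V"
    and AE: "AE p in unit_lborel \<Otimes>\<^sub>M unit_lborel. W (fst p) (snd p) = V (fst p) (snd p)"
    using kernel_borel_version[OF assms(2)] .
  define U where "U x y = 2 * V x y - 1" for x y
  \<comment> \<open>One statement covers W, 1 - W and 2W - 1, and graphs on any vertex type.\<close>
  have affine: "hom_density F (\<lambda>x y. a + b * W x y) = borel_hom_density F (\<lambda>x y. a + b * V x y)"
    if "simple_graph F" for F :: "'w graph" and a b
  proof (rule hom_density_eq_borel_hom_density[OF that is_kernel_affine[OF assms(2)]])
    show "unit.symmetric_kernel (\<lambda>x y. a + b * V x y)"
      by (rule unit.symmetric_kernel_comp[OF V, where g = "\<lambda>t. a + b * t"]) (intro continuous_intros)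
    show "AE p in unit_lborel \<Otimes>\<^sub>M unit_lborel.
        a + b * W (fst p) (snd p) = a + b * V (fst p) (snd p)"
      using AE by eventually_elim simp
  qed
  have U: "unit.symmetric_kernel U"
    unfolding U_def
    by (rule unit.symmetric_kernel_comp[OF V, where g = "\<lambda>t. 2 * t - 1"]) (intro continuous_intros)
  \<comment> \<open>Keeping 1 + U and 1 - U unhalved lets homogeneity produce a common factor
    (1/2)^e(H) on both sides of the hypothesis.\<close>
  define A B where "A x y = 1 + U x y" and "B x y = 1 - U x y" for x y
  have halves: "1 / 2 * A x y = V x y" "1 / 2 * B x y = 1 - V x y" for x y
    by (simp_all add: A_def B_def U_def)
  have A: "unit.symmetric_kernel (\<lambda>x y. 1 / 2 * A x y)"
    unfolding halves by (rule V)
  have B: "unit.symmetric_kernel (\<lambda>x y. 1 / 2 * B x y)"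
    unfolding halves
    by (rule unit.symmetric_kernel_comp[OF V, where g = "\<lambda>t. 1 - t"]) (intro continuous_intros)
  have hU: "hom_density F (\<lambda>x y. 2 * W x y - 1) = borel_hom_density F U"
    and hA: "hom_density F W = borel_hom_density F (\<lambda>x y. 1 / 2 * A x y)"
    and hB: "hom_density F (\<lambda>x y. 1 - W x y) = borel_hom_density F (\<lambda>x y. 1 / 2 * B x y)"
    if "simple_graph F" for F :: "'w graph"
    using affine[OF that, of "-1" 2] affine[OF that, of 0 1] affine[OF that, of 1 "-1"]
    unfolding halves by (simp_all add: U_def[abs_def])
  let ?e = "num_edges H" and ?m = "unit.kernel_moment U"
  have A_eq: "A = (\<lambda>x y. 1 + U x y)" and B_eq: "B = (\<lambda>x y. 1 - U x y)"
    by (simp_all add: A_def[abs_def] B_def[abs_def])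
  have U2: "unit.bounded_fun2 U"
    using U by (rule unit.symmetric_kernel_bounded)
  then have U2': "unit.bounded_fun2 (\<lambda>x y. - U x y)"
    by (rule unit.bounded_fun2_comp[where g = uminus]) (intro continuous_intros)
  have mA: "unit.kernel_moment A 1 = 1 + ?m 1" and mB: "unit.kernel_moment B 1 = 1 - ?m 1"
    using unit.kernel_moment_one_plus[OF U2, of 1] unit.kernel_moment_one_plus[OF U2', of 1]
    by (simp_all add: A_eq B_eq unit.kernel_moment_0 unit.kernel_moment_uminus)
  have K2: "hom_density (complete_graph 2) W = 1 / 2 * (1 + ?m 1)"
    "hom_density (complete_graph 2) (\<lambda>x y. 1 - W x y) = 1 / 2 * (1 - ?m 1)"
    "hom_density (complete_graph 2) (\<lambda>x y. 2 * W x y - 1) = ?m 1"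
    unfolding complete_graph_2 hU[OF simple_path_graph] hA[OF simple_path_graph]
      hB[OF simple_path_graph] borel_hom_density_path_graph[OF A] borel_hom_density_path_graph[OF B]
      borel_hom_density_path_graph[OF U] unit.kernel_moment_scale mA mB
    by simp_all
  have P2: "hom_density (path_graph 2) (\<lambda>x y. 2 * W x y - 1) = ?m 2"
    unfolding hU[OF simple_path_graph] borel_hom_density_path_graph[OF U] ..
  have half: "(2::real) powi (1 - int ?e) = 2 * (1 / 2) ^ ?e"
    by (simp add: power_int_diff power_one_over)
  \<comment> \<open>The hypothesis with that factor removed; 2^(1 - e(H)) leaves 2 behind. The
    variables stand for moments in the path case and traces in the cycle case.\<close>
  have cancel: "x + y \<le> (1 + ?m 1) ^ ?e + (1 - ?m 1) ^ ?e + 2 * \<epsilon>"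
    if "hom_density H W = (1 / 2) ^ ?e * x" "hom_density H (\<lambda>x y. 1 - W x y) = (1 / 2) ^ ?e * y"
    for x y
  proof -
    have "(1 / 2) ^ ?e * (x + y) \<le> (1 / 2) ^ ?e * ((1 + ?m 1) ^ ?e + (1 - ?m 1) ^ ?e + 2 * \<epsilon>)"
      using assms(4) unfolding K2 that half power_mult_distrib by (simp only: algebra_simps)
    then show ?thesis by simp
  qed
  show ?thesis
    using assms(1)
  proof (elim disjE conjE)
    assume "is_path H" and e: "2 \<le> ?e"
    then obtain k where H: "simple_graph H" and iso: "graph_iso H (path_graph k)"
      by (auto simp: is_path_def)
    have k: "?e = k"
      using graph_iso_num_edges[OF H simple_path_graph iso] by (simp add: num_edges_path_graph)
    have "borel_hom_density H X = unit.kernel_moment X ?e" if "unit.symmetric_kernel X" for X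
      using graph_iso_borel_hom_density[OF that H simple_path_graph iso]
      by (simp add: borel_hom_density_path_graph[OF that] k)
    then have "unit.kernel_moment A ?e + unit.kernel_moment B ?e \<le>
        (1 + ?m 1) ^ ?e + (1 - ?m 1) ^ ?e + 2 * \<epsilon>"
      using A B by (intro cancel) (simp_all only: hA[OF H] hB[OF H] unit.kernel_moment_scale)
    then have "(real ?e - 1) * (?m 2 - (?m 1)\<^sup>2) \<le> \<epsilon>"
      unfolding A_eq B_eq by (rule unit.kernel_moment_gap[OF U e])
    then show ?thesis
      unfolding K2 P2 using e by (simp add: field_simps)
  next
    assume "is_cycle H"
    then obtain k where H: "simple_graph H" and "3 \<le> k" and "graph_iso H (cycle_graph k)"
      by (auto simp: is_cycle_def)
    then obtain n where n: "2 \<le> n" and iso: "graph_iso H (cycle_graph (Suc n))"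
      by (cases k) auto
    have C: "simple_graph (cycle_graph (Suc n))"
      using n by (intro simple_cycle_graph) simp
    have k: "?e = Suc n"
      using graph_iso_num_edges[OF H C iso] n by (simp add: num_edges_cycle_graph)
    have "borel_hom_density H X = unit.kernel_trace X n" if "unit.symmetric_kernel X" for X
      using graph_iso_borel_hom_density[OF that H C iso]
      by (simp add: borel_hom_density_cycle_graph[OF that n])
    then have "unit.kernel_trace A n + unit.kernel_trace B n \<le>
        (1 + ?m 1) ^ ?e + (1 - ?m 1) ^ ?e + 2 * \<epsilon>"
      using A B by (intro cancel) (simp_all only: hA[OF H] hB[OF H] unit.kernel_trace_scale k)
    then have "(real n + 1) * (?m 2 - (?m 1)\<^sup>2) \<le> \<epsilon>"
      unfolding A_eq B_eq k by (rule unit.kernel_trace_gap[OF U n])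
    then have "?m 2 - (?m 1)\<^sup>2 \<le> \<epsilon> / (real n + 1)"
      by (simp add: field_simps)
    \<comment> \<open>A cycle gives the denominator e(H) = n + 1; since \<epsilon> is nonnegative,
      it may be lowered to e(H) - 1.\<close>
    also have "\<dots> \<le> \<epsilon> / real n"
      using n assms(3) by (intro divide_left_mono) auto
    finally show ?thesis
      unfolding K2 P2 k by simp
  qed
qed

end
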